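(* Let $0<\alpha'_i<\alpha''_i$ be such that $m_i^{-1}(\alpha''_i)<R_i$ for $1\le i\le K$ (that is, $\alpha''_i=m_i(\theta)$ for some $0<\theta<R_i$). Let $(N_t)_{t\in\mathbb N}$ be positive integers with $N_t<N_{t+1}$ for all $t\in\mathbb N$, and let $n_{it}$ ($1\le i\le K$, $t\in\mathbb N$) be positive integers such that $\alpha_{it}=n_{it}/N_t$ satisfies $0<\alpha'_i<\alpha_{it}<\alpha''_i$ for all $t\in\mathbb N$, $1\le i\le K$. Let $\boldsymbol{s}=(s_1,\dots,s_K)$ be a fixed vector of non-negative integers with $b_{is_i}>0$ for each $1\le i\le K$. Let $\mu_{\boldsymbol{s}t}$ be the number of boxes containing exactly $s_i$ balls of colour $i$ for every $1\le i\le K$ in the multi-colour generalized allocation scheme of placing $n_{it}$ balls of colour $i$ ($1\le i\le K$) into $N_t$ boxes. Put $\theta_{it}=m_i^{-1}(\alpha_{it})$, $$p_{\boldsymbol{s}t}=\prod_{i=1}^K\frac{b_{is_i}\theta_{it}^{s_i}}{s_i!\,B_i(\theta_{it})},\qquad \sigma_{\boldsymbol{s}t}^2=p_{\boldsymbol{s}t}(1-p_{\boldsymbol{s}t}),\qquad \sigma_{\boldsymbol{s}t}=\sqrt{\sigma_{\boldsymbol{s}t}^2}.$$ Then $$\limsup_{t\to\infty}\frac{|\mu_{\boldsymbol{s}t}-\mathbb{E}\mu_{\boldsymbol{s}t}|}{\sqrt{N_t\ln(N_t)}\,\sigma_{\boldsymbol{s}t}}\le 4\sqrt{1+\frac K2}\quad\text{almost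 surely.}$$
   Context: $K\ge1$ is a fixed integer (the number of colours). For each $1\le i\le K$, $(b_{ik})_{k\ge0}$ is a sequence of non-negative real numbers with $b_{i0}>0$, $b_{i1}>0$, such that the power series $B_i(\theta)=\sum_{k=0}^\infty \frac{b_{ik}\theta^k}{k!}$ has positive (possibly infinite) radius of convergence $R_i$. For $0<\theta<R_i$, $\xi_i(\theta)$ denotes a random variable with $\mathbb{P}\{\xi_i(\theta)=k\}=\frac{b_{ik}\theta^k}{k!B_i(\theta)}$, $k=0,1,2,\dots$, and $m_i(\theta)=\mathbb{E}\,\xi_i(\theta)=\theta B_i'(\theta)/B_i(\theta)$. The function $m_i$ is continuous and strictly increasing on $(0,R_i)$, and $m_i^{-1}$ is its inverse. Multi-colour generalized allocation scheme: for $N$ boxes and $n_i$ balls of colour $i$ ($1\le i\le K$), it is a family of random vectors $\boldsymbol{\eta}_j=(\eta_{1j},\dots,\eta_{Kj})$, $1\le j\le N$, with non-negative integer coordinates ($\eta_{ij}$ is the number of balls of colour $i$ in box $j$) whose joint distribution is $$\mathbb{P}\{\boldsymbol{\eta}_1=\boldsymbol{k}_1,\dots,\boldsymbol{\eta}_N=\boldsymbol{k}_N\}=\prod_{i=1}^K\mathbb{P}\{\xi_{i1}=k_{i1},\dots,\xi_{iN}=k_{iN}\mid \xi_{i1}+\dots+\xi_{iN}=n_i\}$$ for all non-negative integer vectors $\boldsymbol{k}_j=(k_{1j},\dots,k_{Kj})$ with $k_{i1}+\dots+k_{iN}=n_i$, $1\le i\le K$. Here all $\xi_{ij}$ are independent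 and, for each $i$, $\xi_{i1},\dots,\xi_{iN}$ are independent copies of $\xi_i(\theta_i)$ for some $\theta_i\in(0,R_i)$ (the conditional distribution does not depend on the choice of $\theta_i$). The number of boxes with contents exactly $\boldsymbol{s}=(s_1,\dots,s_K)$ is $\sum_{j=1}^{N}\prod_{i=1}^K\mathbb{I}_{\{\eta_{ij}=s_i\}}$, where $\mathbb{I}$ denotes the indicator. For different $t$ the allocation schemes are defined on one common probability space; nothing is assumed about their joint distribution. The scheme is considered for parameters for which the conditioning events have positive probability (under the hypotheses on the ratios this holds for all sufficiently large $N_t$). *)

theory Defs
  imports "HOL-Probability.Probability"
begin

text \<open>
  A sequence \<open>b\<close> of non-negative reals stands for the coefficients
  \<open>b\<^sub>i\<^sub>0, b\<^sub>i\<^sub>1, \<dots>\<close> of a single colour \<open>i\<close>.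
\<close>

definition gen_fun :: "(nat \<Rightarrow> real) \<Rightarrow> real \<Rightarrow> real" where
  "gen_fun b \<theta> = (\<Sum>k. b k * \<theta> ^ k / fact k)"

definition gen_radius :: "(nat \<Rightarrow> real) \<Rightarrow> ereal" where
  "gen_radius b = conv_radius (\<lambda>k. b k / fact k)"

definition params :: "(nat \<Rightarrow> real) \<Rightarrow> real set" where
  "params b = {\<theta>. 0 < \<theta> \<and> ereal \<theta> < gen_radius b}"

text \<open>
  The law of \<open>\<xi>(\<theta>)\<close>, meaningful only for \<open>\<theta> \<in> params b\<close> (see \<open>pmf_xi_pmf\<close> below).
\<close>

definition xi_pmf :: "(nat \<Rightarrow> real) \<Rightarrow> real \<Rightarrow> nat pmf" where
  "xi_pmf b \<theta> = embed_pmf (\<lambda>k. b k * \<theta> ^ k / (fact k * gen_fun b \<theta>))"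

lemma pmf_xi_pmf:
  assumes nonneg: "\<And>k. b k \<ge> 0" and pos: "b 0 > 0" and \<theta>: "\<theta> \<in> params b"
  shows "pmf (xi_pmf b \<theta>) k = b k * \<theta> ^ k / (fact k * gen_fun b \<theta>)"
proof -
  have \<theta>0: "0 < \<theta>" and \<theta>R: "ereal (norm \<theta>) < conv_radius (\<lambda>k. b k / fact k)"
    using \<theta> by (auto simp: params_def gen_radius_def)
  have summ: "summable (\<lambda>k. b k * \<theta> ^ k / fact k)"
    using summable_in_conv_radius[OF \<theta>R] by (simp add: field_simps)
  have ge0: "b k * \<theta> ^ k / fact k \<ge> 0" for k
    using nonneg \<theta>0 by simp
  have B: "gen_fun b \<theta> > 0"
    unfolding gen_fun_def by (rule suminf_pos2[where i = 0, OF summ]) (use ge0 pos in auto)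
  have "(\<lambda>k. b k * \<theta> ^ k / fact k / gen_fun b \<theta>) sums (gen_fun b \<theta> / gen_fun b \<theta>)"
    unfolding gen_fun_def by (intro sums_divide summable_sums summ)
  hence s1: "(\<lambda>k. b k * \<theta> ^ k / (fact k * gen_fun b \<theta>)) sums 1"
    using B by simp
  have nn: "b k * \<theta> ^ k / (fact k * gen_fun b \<theta>) \<ge> 0" for k
    using nonneg \<theta>0 B by simp
  have "(\<integral>\<^sup>+k. ennreal (b k * \<theta> ^ k / (fact k * gen_fun b \<theta>)) \<partial>count_space UNIV)
        = (\<Sum>k. ennreal (b k * \<theta> ^ k / (fact k * gen_fun b \<theta>)))"
    by (rule nn_integral_count_space_nat)
  also have "\<dots> = ennreal 1"
    using s1 nn by (intro suminf_ennreal_eq) auto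
  finally show ?thesis
    unfolding xi_pmf_def using nn by (intro pmf_embed_pmf) auto
qed

definition xi_mean :: "(nat \<Rightarrow> real) \<Rightarrow> real \<Rightarrow> real" where
  "xi_mean b \<theta> = measure_pmf.expectation (xi_pmf b \<theta>) real"

definition xi_mean_inv :: "(nat \<Rightarrow> real) \<Rightarrow> real \<Rightarrow> real" where
  "xi_mean_inv b \<alpha> = inv_into (params b) (xi_mean b) \<alpha>"

text \<open>
  The joint law of \<open>N\<close> independent copies of \<open>\<xi>(\<theta>)\<close>, indexed by the boxes \<open>1, \<dots>, N\<close>.
\<close>

definition xi_sample :: "(nat \<Rightarrow> real) \<Rightarrow> real \<Rightarrow> nat \<Rightarrow> (nat \<Rightarrow> nat) pmf" where
  "xi_sample b \<theta> N = Pi_pmf {1..N} 0 (\<lambda>_. xi_pmf b \<theta>)"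

text \<open>
  The conditioning events have positive probability. Whether this is so does not depend on
  the choice of the parameters \<open>\<theta> i\<close>.
\<close>

definition allocation_possible ::
  "nat \<Rightarrow> (nat \<Rightarrow> nat \<Rightarrow> real) \<Rightarrow> nat \<Rightarrow> (nat \<Rightarrow> nat) \<Rightarrow> bool" where
  "allocation_possible K b N n \<longleftrightarrow>
     (\<exists>\<theta>. \<forall>i\<in>{1..K}. \<theta> i \<in> params (b i) \<and>
        \<P>(x in xi_sample (b i) (\<theta> i) N. (\<Sum>j=1..N. x j) = n i) > 0)"

text \<open>
  \<open>\<eta> i j\<close> is the number of balls of colour \<open>i\<close> in box \<open>j\<close>; there are \<open>n i\<close> balls of colour \<open>i\<close>
  and \<open>N\<close> boxes. As the conditional probability is \<open>0\<close> when the conditioning event is null, this is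
  meant to be used only where \<^const>\<open>allocation_possible\<close> holds.
\<close>

definition allocation_scheme ::
  "'w measure \<Rightarrow> nat \<Rightarrow> (nat \<Rightarrow> nat \<Rightarrow> real) \<Rightarrow> nat \<Rightarrow> (nat \<Rightarrow> nat) \<Rightarrow>
     (nat \<Rightarrow> nat \<Rightarrow> 'w \<Rightarrow> nat) \<Rightarrow> bool" where
  "allocation_scheme M K b N n \<eta> \<longleftrightarrow>
     (\<exists>\<theta>. (\<forall>i\<in>{1..K}. \<theta> i \<in> params (b i)) \<and>
        (\<forall>k :: nat \<Rightarrow> nat \<Rightarrow> nat. (\<forall>i\<in>{1..K}. (\<Sum>j=1..N. k i j) = n i) \<longrightarrow>
           \<P>(\<omega> in M. \<forall>i\<in>{1..K}. \<forall>j\<in>{1..N}. \<eta> i j \<omega> = k i j) =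
           (\<Prod>i=1..K. \<P>(x in xi_sample (b i) (\<theta> i) N.
              (\<forall>j\<in>{1..N}. x j = k i j) \<bar> (\<Sum>j=1..N. x j) = n i))))"

definition num_boxes ::
  "nat \<Rightarrow> nat \<Rightarrow> (nat \<Rightarrow> nat) \<Rightarrow> (nat \<Rightarrow> nat \<Rightarrow> 'w \<Rightarrow> nat) \<Rightarrow> 'w \<Rightarrow> real" where
  "num_boxes K N s \<eta> \<omega> = (\<Sum>j=1..N. \<Prod>i=1..K. of_bool (\<eta> i j \<omega> = s i))"

definition box_prob ::
  "nat \<Rightarrow> (nat \<Rightarrow> nat \<Rightarrow> real) \<Rightarrow> (nat \<Rightarrow> real) \<Rightarrow> (nat \<Rightarrow> nat) \<Rightarrow> real" where
  "box_prob K b \<theta> s =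
     (\<Prod>i=1..K. b i (s i) * \<theta> i ^ s i / (fact (s i) * gen_fun (b i) (\<theta> i)))"

end

theory Submission imports Defs "HOL-Real_Asymp.Real_Asymp" begin

text \<open>
  Under the unconditioned product law \<open>Q\<close>, in which all \<open>\<xi>\<^sub>i\<^sub>j\<close> are independent and colour \<open>i\<close>
  has the parameter \<open>\<theta>\<^sub>i\<^sub>t\<close>, the boxes are independent and each of them has contents \<open>s\<close> with
  probability \<open>p = p\<^sub>s\<^sub>t\<close>. The number of such boxes is then binomial, and Bernstein's inequality
  (\<open>Bernstein_Pi_pmf\<close>) bounds the probability of a deviation from \<open>N p\<close> by at least
  \<open>c \<surd>(N ln N) \<sigma>\<close> by \<open>2 N\<^bsup>-c\<^sup>2/4\<^esup>\<close>, for large \<open>N\<close>.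

  The allocation scheme is \<open>Q\<close> conditioned on the totals \<open>n\<^sub>i\<close> of the \<open>K\<close> colours. Conditioning multiplies
  probabilities by at most the reciprocal of the probability of the condition
  (\<open>allocation_scheme_prob_le\<close>). The parameter is chosen so that \<open>n\<^sub>i\<close> is exactly the mean of
  the sum of colour \<open>i\<close>, and the probability that a sum of \<open>N\<close> independent copies hits its mean is
  at least of order \<open>N\<^bsup>-1/2\<^esup>\<close>, uniformly in the parameter (\<open>prob_sum_eq_mean_ge\<close>). Thus the
  price of conditioning is \<open>N\<^bsup>K/2\<^esup>\<close>, and the tail in the scheme is at most
  \<open>C N\<^bsup>K/2 - c\<^sup>2/4\<^esup>\<close>.

  The lower bound for hitting the mean avoids characteristic functions. Since \<open>0\<close> and \<open>1\<close> both have
  probability at least some \<open>q > 0\<close>, the law of \<open>\<xi>\<close> is a mixture in which, with probability \<open>q\<close>, the value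
  is decided by a fair coin (\<open>coin_mixture\<close>). Given everything except these coins, the sum is a
  shifted binomial variable with about \<open>q N\<close> trials; by Chebyshev's inequality its centre is within
  \<open>O(\<surd>N)\<close> of the target with probability at least \<open>1/2\<close>, and there a symmetric binomial law has
  weights of order \<open>N\<^bsup>-1/2\<^esup>\<close>.

  As \<open>N\<^sub>t \<ge> t\<close>, the tail bound is summable in \<open>t\<close> when \<open>c\<^sup>2 > 4 + 2 K\<close>, so by Borel and Cantelli
  \<open>|\<mu> - N p|\<close> is almost surely eventually below \<open>c\<close> times the normalisation for every \<open>c > 2\<surd>(1 + K/2)\<close>.
  Integrating the tail bound replaces \<open>N p\<close> by the expectation at the cost of one more
  term of this kind, with a constant strictly below \<open>2\<surd>(1 + K/2)\<close>. The two constants can be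
  made to add up to \<open>4\<surd>(1 + K/2)\<close> (\<open>limsup_deviation_from_mean_le\<close>).

  All constants have to be uniform in \<open>t\<close>. The mean of \<open>\<xi>(\<theta>)\<close> is monotone in \<open>\<theta>\<close>, so ratios
  between \<open>\<alpha>'\<close> and \<open>\<alpha>''\<close> force \<open>\<theta>\<^sub>i\<^sub>t\<close> into a compact part of the parameter range
  (\<open>xi_mean_inv_compact\<close>), where the point probabilities in question are bounded away from \<open>0\<close> and
  \<open>1\<close> and the second moments are bounded (\<open>xi_pmf_uniform_bounds\<close>).
\<close>


section \<open>Binomial coefficients near the middle\<close>

text \<open>
  Consecutive central coefficients have the ratio \<open>2 (2 m + 1) / (m + 1)\<close>. By the inequality of the
  arithmetic and geometric means, \<open>2 \<surd>(m (m + 1)) \<le> 2 m + 1\<close>, so this ratio is at least the ratio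
  \<open>4 \<surd>(m / (m + 1))\<close> of the claimed lower bounds.
\<close>
lemma central_binomial_ge:
  assumes "m \<ge> 1"
  shows "4 ^ m / (2 * sqrt (real m)) \<le> real ((2 * m) choose m)"
  using assms
proof (induction m rule: dec_induct)
  case base
  then show ?case by simp
next
  case (step m)
  have m: "0 < real m" using step by simp
  have "(2 * m + 2) choose (m + 1) = 2 * ((2 * m + 1) choose m)"
    using binomial_symmetric[of "m" "2*m+1"] by (simp add: choose_reduce_nat)
  moreover have "(m + 1) * ((2 * m + 1) choose m) = (2 * m + 1) * ((2 * m) choose m)"
    using binomial_absorb_comp[of "2*m+1" m] by simp
  ultimately have rec:
    "real ((2 * Suc m) choose Suc m) = 2 * (2 * real m + 1) / (real m + 1) * real ((2 * m) choose m)"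
  proof -
    assume a: "(2 * m + 2) choose (m + 1) = 2 * ((2 * m + 1) choose m)"
      and b: "(m + 1) * ((2 * m + 1) choose m) = (2 * m + 1) * ((2 * m) choose m)"
    have "(real m + 1) * real ((2 * m + 1) choose m) = (2 * real m + 1) * real ((2 * m) choose m)"
      using arg_cong[OF b, of real] by (simp add: algebra_simps)
    then show ?thesis using a by (simp add: field_simps)
  qed
  have "2 * sqrt (real m) * sqrt (real m + 1) \<le> 2 * real m + 1"
    using m arith_geo_mean_sqrt[of "real m" "real m + 1"] by (simp add: real_sqrt_mult)
  then have "4 * sqrt (real m) * (real m + 1) \<le> 2 * (2 * real m + 1) * sqrt (real m + 1)"
    using mult_right_mono[of "2 * sqrt (real m) * sqrt (real m + 1)" "2 * real m + 1" "2 * sqrt (real m + 1)"]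
    by (simp add: field_simps)
  then have key: "4 * sqrt (real m) * (real m + 1) \<le> 2 * (2 * real m + 1) * sqrt (real (Suc m))"
    by (simp only: of_nat_Suc add.commute)
  have frac: "4 / (2 * y) \<le> w / v / (2 * x)" if "4 * x * v \<le> w * y" "x > 0" "y > 0" "v > 0"
    for x y v w :: real
    using that by (simp add: divide_simps) (simp only: mult.assoc mult.commute mult.left_commute)
  have "4 / (2 * sqrt (real (Suc m))) \<le> 2 * (2 * real m + 1) / (real m + 1) / (2 * sqrt (real m))"
    by (rule frac[OF key]) (use m in auto)
  then have "4 ^ m * (4 / (2 * sqrt (real (Suc m))))
      \<le> 4 ^ m * (2 * (2 * real m + 1) / (real m + 1) / (2 * sqrt (real m)))"
    by (rule mult_left_mono) simp
  also have "\<dots> = 2 * (2 * real m + 1) / (real m + 1) * (4 ^ m / (2 * sqrt (real m)))"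
    by simp
  also have "\<dots> \<le> 2 * (2 * real m + 1) / (real m + 1) * real ((2 * m) choose m)"
    by (rule mult_left_mono) (use step.IH in auto)
  finally show ?case using rec by (simp add: mult.commute)
qed

text \<open>
  In an odd row, twice the middle entry is the central entry of the next row.
\<close>
lemma middle_binomial_ge:
  assumes "J \<ge> 1"
  shows "2 ^ J / (2 * sqrt (real J)) \<le> real (J choose (J div 2))"
proof (cases "even J")
  case True
  then obtain m where J: "J = 2 * m" by blast
  have "2 ^ J / (2 * sqrt (real J)) \<le> 4 ^ m / (2 * sqrt (real m))"
    unfolding J power_mult using assms J by (intro frac_le) auto
  also have "\<dots> \<le> real (J choose (J div 2))"
    using central_binomial_ge[of m] assms J by simp
  finally show ?thesis .
next
  case False
  then obtain m where J: "J = 2 * m + 1" by (auto elim: oddE)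
  have c: "(2 * Suc m) choose Suc m = 2 * (J choose (J div 2))"
    using binomial_symmetric[of m "2*m+1"] J by (simp add: choose_reduce_nat)
  have "2 ^ J / (2 * sqrt (real J)) \<le> 2 ^ J / (2 * sqrt (real (Suc m)))"
    using J by (intro frac_le) auto
  also have "\<dots> = 4 ^ Suc m / (2 * sqrt (real (Suc m))) / 2"
    unfolding J by (simp add: power_mult)
  also have "\<dots> \<le> real ((2 * Suc m) choose Suc m) / 2"
    using central_binomial_ge[of "Suc m"] by (intro divide_right_mono) auto
  also have "\<dots> = real (J choose (J div 2))"
    using c by simp
  finally show ?thesis .
qed

text \<open>
  Moving from distance \<open>d\<close> to \<open>d + 1\<close> below the middle \<open>h\<close> multiplies the coefficient by
  \<open>(h - d) / (J - h + d + 1)\<close>, which is \<open>1 - O((d + 1) / J)\<close>.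
\<close>
lemma binomial_below_middle_ge:
  assumes "d \<le> D" "D \<le> J div 2" "4 * D \<le> J" "J > 0"
  shows "(1 - 4 * real D / real J) ^ d * real (J choose (J div 2)) \<le> real (J choose (J div 2 - d))"
  using assms(1)
proof (induction d)
  case (Suc d)
  let ?h = "J div 2"
  let ?y = "4 * real D / real J"
  have y: "0 \<le> 1 - ?y" using assms by (simp add: field_simps)
  have hd: "Suc d \<le> ?h" using Suc assms by simp
  then have e: "?h - d = Suc (?h - Suc d)" by simp
  have "(?h - d) * (J choose (?h - d)) = (J - (?h - Suc d)) * (J choose (?h - Suc d))"
    unfolding e using binomial_absorption[of "?h - Suc d" J] binomial_absorb_comp[of J "?h - Suc d"]
    by (simp add: mult.commute)
  then have rec: "real (?h - d) * real (J choose (?h - d))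
      = real (J - (?h - Suc d)) * real (J choose (?h - Suc d))"
    by (metis of_nat_mult)
  let ?a = "real (?h - d)" and ?b = "real (J - (?h - Suc d))"
  have b0: "?b > 0" and b: "?b = real J - real ?h + real d + 1" and a: "?a = real ?h - real d"
    using hd assms by (auto simp: of_nat_diff)
  have h: "2 * real ?h \<le> real J" "real J \<le> 2 * real ?h + 1" by linarith+
  have "(1 - ?y) * ?b \<le> ?a"
  proof -
    have bJ: "real J / 2 \<le> ?b" unfolding b using h(1) by linarith
    have y2: "?y * (real J / 2) = 2 * real D" using assms by simp
    have "2 * real D \<le> ?y * ?b"
      unfolding y2[symmetric] by (rule mult_left_mono[OF bJ]) simp
    moreover have "real d + 1 \<le> real D" using Suc.prems by linarith
    ultimately have "?b - ?y * ?b \<le> ?a"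
      unfolding a b using h(2) by linarith
    then show ?thesis by (simp only: left_diff_distrib mult_1_left)
  qed
  then have ab: "1 - ?y \<le> ?a / ?b" using b0 by (simp add: field_simps)
  have "(1 - ?y) ^ Suc d * real (J choose ?h) = (1 - ?y) * ((1 - ?y) ^ d * real (J choose ?h))"
    by simp
  also have "\<dots> \<le> ?a / ?b * real (J choose (?h - d))"
    by (rule mult_mono[OF ab]) (use Suc y in auto)
  also have "\<dots> = real (J choose (?h - Suc d))"
    using rec b0 by (simp add: field_simps)
  finally show ?case .
qed simp

lemma one_minus_ge_exp:
  fixes y :: real
  assumes "0 \<le> y" "y \<le> 1/2"
  shows "exp (- 2 * y) \<le> 1 - y"
proof -
  have "- 2 * y \<le> - y - 2 * y\<^sup>2"
    using assms mult_left_mono[of y "1/2" y] by (simp add: power2_eq_square)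
  also have "\<dots> \<le> ln (1 - y)"
    by (rule ln_one_minus_pos_lower_bound) (use assms in auto)
  finally have "exp (- 2 * y) \<le> exp (ln (1 - y))" by simp
  then show ?thesis using assms by simp
qed

text \<open>
  At distance at most \<open>A \<surd>J\<close> from the middle, at most \<open>A \<surd>J\<close> factors \<open>1 - O(A / \<surd>J)\<close> are lost,
  that is, only a factor depending on \<open>A\<close>. The bound on \<open>J\<close> makes each of these factors at
  least \<open>1/2\<close>, so that the lower bound \<open>exp (- 2 y) \<le> 1 - y\<close> applies, and keeps the window
  inside \<open>[0, J]\<close>.
\<close>
lemma binomial_near_middle_ge:
  fixes A :: real
  assumes A: "A \<ge> 0" and J: "real J \<ge> 64 * A\<^sup>2 + 1" and k: "\<bar>real k - real J / 2\<bar> \<le> A * sqrt (real J)"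
  shows "exp (- 8 * A\<^sup>2) / 2 / sqrt (real J) \<le> real (J choose k) / 2 ^ J"
proof -
  have J0: "real J \<ge> 1" using J by (smt (verit) zero_le_power2)
  have "64 * A\<^sup>2 \<le> real J" using J by simp
  then have "sqrt (64 * A\<^sup>2) \<le> sqrt (real J)" by (rule real_sqrt_le_mono)
  then have sA: "8 * A \<le> sqrt (real J)" using A by (simp add: real_sqrt_mult)
  then have AJ: "8 * (A * sqrt (real J)) \<le> real J"
    using mult_right_mono[OF sA, of "sqrt (real J)"] by simp
  have below: "exp (- 8 * A\<^sup>2) / 2 / sqrt (real J) \<le> real (J choose k) / 2 ^ J"
    if kh: "k \<le> J div 2" and k: "\<bar>real k - real J / 2\<bar> \<le> A * sqrt (real J)" for k
  proof -
    define d where "d = J div 2 - k"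
    have kd: "k = J div 2 - d" using kh d_def by simp
    have "real (J div 2) \<le> real J / 2" by linarith
    then have d: "real d \<le> A * sqrt (real J)" using k kh unfolding d_def by (simp add: of_nat_diff)
    define y where "y = 4 * real d / real J"
    have y0: "0 \<le> y" unfolding y_def by simp
    have y2: "y \<le> 1/2" unfolding y_def using d AJ J0 by (simp add: field_simps)
    have "4 * d \<le> J" using d AJ by linarith
    moreover have "d \<le> J div 2" unfolding d_def by simp
    ultimately have 1: "(1 - y) ^ d * real (J choose (J div 2)) \<le> real (J choose k)"
      unfolding y_def kd using binomial_below_middle_ge[of d d J] J0 by simp
    have "(real d)\<^sup>2 \<le> (A * sqrt (real J))\<^sup>2" by (rule power_mono[OF d]) simp
    then have "2 * y * real d \<le> 8 * A\<^sup>2"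
      unfolding y_def using J0 by (simp add: field_simps power2_eq_square)
    then have "exp (- 8 * A\<^sup>2) \<le> exp (- 2 * y * real d)" by simp
    also have "\<dots> = exp (- 2 * y) ^ d" by (simp add: exp_of_nat_mult[symmetric] mult.commute)
    also have "\<dots> \<le> (1 - y) ^ d"
      by (rule power_mono[OF one_minus_ge_exp[OF y0 y2]]) simp
    finally have 2: "exp (- 8 * A\<^sup>2) \<le> (1 - y) ^ d" .
    have "exp (- 8 * A\<^sup>2) * (2 ^ J / (2 * sqrt (real J))) \<le> (1 - y) ^ d * real (J choose (J div 2))"
      by (rule mult_mono[OF 2 middle_binomial_ge]) (use J0 y2 in auto)
    then show ?thesis using 1 by (simp add: field_simps)
  qed
  show ?thesis
  proof (cases "k \<le> J div 2")
    case True
    then show ?thesis using below k by blast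
  next
    case False
    have kJ: "k \<le> J"
      using k AJ J0 by linarith
    have "exp (- 8 * A\<^sup>2) / 2 / sqrt (real J) \<le> real (J choose (J - k)) / 2 ^ J"
    proof (rule below)
      show "J - k \<le> J div 2" using False by simp
      show "\<bar>real (J - k) - real J / 2\<bar> \<le> A * sqrt (real J)" using k kJ by (simp add: of_nat_diff)
    qed
    then show ?thesis using binomial_symmetric[OF kJ] by simp
  qed
qed

section \<open>The variance of an independent sum\<close>

text \<open>
  Independence and centring make the mixed terms vanish.
\<close>
lemma expectation_sum_squared_Pi_pmf:
  fixes g :: "'a \<Rightarrow> real" and A :: "'i set"
  assumes fin: "finite A" and int2: "integrable (measure_pmf W) (\<lambda>x. (g x)\<^sup>2)"
    and mean: "measure_pmf.expectation W g = 0"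
  shows "integrable (measure_pmf (Pi_pmf A d (\<lambda>_. W))) (\<lambda>x. (\<Sum>i\<in>A. g (x i))\<^sup>2)"
    and "measure_pmf.expectation (Pi_pmf A d (\<lambda>_. W)) (\<lambda>x. (\<Sum>i\<in>A. g (x i))\<^sup>2)
           = real (card A) * measure_pmf.expectation W (\<lambda>x. (g x)\<^sup>2)"
proof -
  let ?P = "Pi_pmf A d (\<lambda>_. W)"
  have int: "integrable (measure_pmf W) g"
    by (rule measure_pmf.square_integrable_imp_integrable[OF _ int2]) simp
  have comp: "map_pmf (\<lambda>x. x i) ?P = W" if "i \<in> A" for i
    using Pi_pmf_component[OF fin, of i d "\<lambda>_. W"] that by simp
  have comp_int: "integrable (measure_pmf ?P) (\<lambda>x. h (x i)) \<longleftrightarrow> integrable (measure_pmf W) h"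
    and comp_exp: "measure_pmf.expectation ?P (\<lambda>x. h (x i)) = measure_pmf.expectation W h"
    if "i \<in> A" for i and h :: "'a \<Rightarrow> real"
    using integrable_map_pmf_eq[of "\<lambda>x. x i" ?P h] integral_map_pmf[of "\<lambda>x. x i" ?P h]
    by (simp_all only: comp[OF that])
  have cross: "integrable (measure_pmf ?P) (\<lambda>x. g (x i) * g (x j)) \<and>
      measure_pmf.expectation ?P (\<lambda>x. g (x i) * g (x j))
        = (if i = j then measure_pmf.expectation W (\<lambda>x. (g x)\<^sup>2) else 0)"
    if ij: "i \<in> A" "j \<in> A" for i j
  proof (cases "i = j")
    case True
    then show ?thesis
      using comp_int[OF ij(1), of "\<lambda>y. (g y)\<^sup>2"] comp_exp[OF ij(1), of "\<lambda>y. (g y)\<^sup>2"] int2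
      by (simp add: power2_eq_square)
  next
    case False
    have "prob_space.indep_vars (measure_pmf ?P) (\<lambda>_. borel) (\<lambda>i x. g (x i)) A"
      by (rule prob_space.indep_vars_compose2[OF measure_pmf.prob_space_axioms indep_vars_Pi_pmf[OF fin]]) simp
    then have ind: "prob_space.indep_vars (measure_pmf ?P) (\<lambda>_. borel) (\<lambda>i x. g (x i)) {i, j}"
      by (rule prob_space.indep_vars_subset[OF measure_pmf.prob_space_axioms]) (use ij in auto)
    have int_ij: "integrable (measure_pmf ?P) (\<lambda>x. g (x k))" if "k \<in> {i, j}" for k
      using comp_int[of k g] int that ij by auto
    note 1 = prob_space.indep_vars_lebesgue_integral[OF measure_pmf.prob_space_axioms _ ind int_ij]
    note 2 = prob_space.indep_vars_integrable[OF measure_pmf.prob_space_axioms _ ind int_ij]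
    show ?thesis using 1 2 False comp_exp[OF ij(1), of g] mean by simp
  qed
  have sq: "(\<Sum>i\<in>A. g (x i))\<^sup>2 = (\<Sum>i\<in>A. \<Sum>j\<in>A. g (x i) * g (x j))" for x
    by (simp add: power2_eq_square sum_product)
  show "integrable (measure_pmf ?P) (\<lambda>x. (\<Sum>i\<in>A. g (x i))\<^sup>2)"
    unfolding sq using cross by (intro Bochner_Integration.integrable_sum) auto
  show "measure_pmf.expectation ?P (\<lambda>x. (\<Sum>i\<in>A. g (x i))\<^sup>2)
           = real (card A) * measure_pmf.expectation W (\<lambda>x. (g x)\<^sup>2)"
    unfolding sq using cross
    by (subst Bochner_Integration.integral_sum, (auto intro!: Bochner_Integration.integrable_sum)[1])
       (simp add: Bochner_Integration.integral_sum fin sum.If_cases)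
qed

lemma Chebyshev_Pi_pmf:
  fixes g :: "'a \<Rightarrow> real" and A :: "'i set"
  assumes fin: "finite A" and int2: "integrable (measure_pmf W) (\<lambda>x. (g x)\<^sup>2)"
    and mean: "measure_pmf.expectation W g = m"
    and V: "measure_pmf.expectation W (\<lambda>x. (g x)\<^sup>2) \<le> V" and a: "a > 0"
  shows "measure_pmf.prob (Pi_pmf A d (\<lambda>_. W)) {x. \<bar>(\<Sum>i\<in>A. g (x i)) - real (card A) * m\<bar> \<ge> a}
           \<le> real (card A) * V / a\<^sup>2"
proof -
  let ?P = "Pi_pmf A d (\<lambda>_. W)"
  have int: "integrable (measure_pmf W) g"
    by (rule measure_pmf.square_integrable_imp_integrable[OF _ int2]) simp
  have int2': "integrable (measure_pmf W) (\<lambda>x. (g x - m)\<^sup>2)"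
    using int int2 by (simp add: power2_diff)
  have mean': "measure_pmf.expectation W (\<lambda>x. g x - m) = 0"
    using int mean by simp
  have var: "measure_pmf.expectation W (\<lambda>x. (g x - m)\<^sup>2) \<le> V"
    using measure_pmf.variance_eq[OF int int2] V zero_le_power2[of m] unfolding mean by linarith
  let ?S = "\<lambda>x. (\<Sum>i\<in>A. g (x i) - m)"
  note sq = expectation_sum_squared_Pi_pmf[OF fin int2' mean', of d]
  have "measure_pmf.prob ?P {x. \<bar>(\<Sum>i\<in>A. g (x i)) - real (card A) * m\<bar> \<ge> a}
      = measure_pmf.prob ?P {x. (?S x)\<^sup>2 \<ge> a\<^sup>2}"
    using a by (auto simp: sum_subtractf abs_le_square_iff[symmetric] intro!: arg_cong[where f = "measure_pmf.prob ?P"])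
  also have "\<dots> \<le> measure_pmf.expectation ?P (\<lambda>x. (?S x)\<^sup>2) / a\<^sup>2"
    using integral_Markov_inequality_measure[OF sq(1), of "{}" "a\<^sup>2"] a by simp
  also have "\<dots> \<le> real (card A) * V / a\<^sup>2"
    unfolding sq(2) using var by (intro divide_right_mono mult_left_mono) auto
  finally show ?thesis .
qed

section \<open>Splitting a fair coin off a law on the natural numbers\<close>

definition coin :: "nat pmf" where
  "coin = map_pmf of_bool (bernoulli_pmf (1/2))"

text \<open>
  An outcome \<open>None\<close> means that the value is still to be decided by a fair coin on \<open>{0, 1}\<close>.
\<close>
definition coin_or :: "nat option \<Rightarrow> nat pmf" where
  "coin_or w = (case w of None \<Rightarrow> coin | Some k \<Rightarrow> return_pmf k)"

lemma coin_or_simps [simp]: "coin_or None = coin" "coin_or (Some k) = return_pmf k"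
  by (simp_all add: coin_or_def)

lemma pmf_coin: "pmf coin x = (if x \<le> 1 then 1/2 else 0)"
proof -
  have "x = of_bool c" if "x \<le> 1" "c = (x = 1)" for c using that by auto
  moreover have "inj (of_bool :: bool \<Rightarrow> nat)" by (auto simp: inj_def)
  ultimately have "x \<le> 1 \<Longrightarrow> pmf coin x = 1/2"
    unfolding coin_def using pmf_map_inj'[of "of_bool :: bool \<Rightarrow> nat" "bernoulli_pmf (1/2)" "x = 1"]
    by (metis pmf_bernoulli_half)
  moreover have "pmf coin x = 0" if "x > 1"
    using that by (auto simp: coin_def pmf_eq_0_set_pmf of_bool_def split: if_splits)
  ultimately show ?thesis by auto
qed

text \<open>
  Given the outcomes \<open>w\<close>, only the undecided coins are random, and they add up to a binomial variable.
\<close>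
lemma sum_coin_or:
  assumes "finite A"
  shows "map_pmf (\<lambda>x. \<Sum>j\<in>A. x j) (Pi_pmf A 0 (\<lambda>j. coin_or (w j)))
    = map_pmf (\<lambda>h. h + (\<Sum>j\<in>A. case_option 0 id (w j)))
        (binomial_pmf (card {j \<in> A. w j = None}) (1/2))"
  using assms
proof (induction A)
  case empty
  then show ?case by (simp add: binomial_pmf_0)
next
  case (insert a A)
  let ?S = "map_pmf (\<lambda>x. \<Sum>j\<in>A. x j) (Pi_pmf A 0 (\<lambda>j. coin_or (w j)))"
  let ?T = "\<Sum>j\<in>A. case_option 0 id (w j)"
  have upd: "(\<Sum>j\<in>A. if j = a then y else f j) = (\<Sum>j\<in>A. f j)" for f :: "'a \<Rightarrow> nat" and y
    using insert.hyps by (intro sum.cong) auto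
  have "map_pmf (\<lambda>x. \<Sum>j\<in>insert a A. x j) (Pi_pmf (insert a A) 0 (\<lambda>j. coin_or (w j)))
      = bind_pmf (coin_or (w a)) (\<lambda>y. map_pmf (\<lambda>s. y + s) ?S)"
    using insert.hyps upd
    by (simp add: Pi_pmf_insert' map_pmf_def bind_assoc_pmf bind_return_pmf)
  also have "\<dots> = map_pmf (\<lambda>h. h + (\<Sum>j\<in>insert a A. case_option 0 id (w j)))
        (binomial_pmf (card {j \<in> insert a A. w j = None}) (1/2))"
  proof (cases "w a")
    case None
    then have "{j \<in> insert a A. w j = None} = insert a {j \<in> A. w j = None}" by auto
    then have c: "card {j \<in> insert a A. w j = None} = Suc (card {j \<in> A. w j = None})"
      using insert.hyps by simp
    show ?thesis unfolding insert.IH c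
      using insert.hyps None
      by (simp add: binomial_pmf_Suc map_bind_pmf coin_def bind_map_pmf pmf.map_comp o_def)
         (simp add: map_pmf_def bind_assoc_pmf bind_return_pmf of_bool_def add.assoc)
  next
    case (Some k)
    then have c: "{j \<in> insert a A. w j = None} = {j \<in> A. w j = None}" by auto
    show ?thesis unfolding insert.IH c
      using insert.hyps Some
      by (simp add: bind_return_pmf pmf.map_comp o_def add.left_commute)
  qed
  finally show ?case .
qed

text \<open>
  Take mass \<open>q / 2\<close> away from each of the values \<open>0\<close> and \<open>1\<close> and let \<open>None\<close> collect it. Counting
  an undecided coin by its mean \<open>1 / 2\<close> leaves the expectation unchanged.
\<close>
lemma coin_mixture:
  fixes D :: "nat pmf"
  assumes q: "0 < q" "q \<le> pmf D 0" "q \<le> pmf D 1"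
    and int2: "integrable (measure_pmf D) (\<lambda>k. (real k)\<^sup>2)"
  obtains W where "D = bind_pmf W coin_or"
    "measure_pmf.expectation W (\<lambda>w. of_bool (w = None)) = q"
    "measure_pmf.expectation W (case_option (1/2) real) = measure_pmf.expectation D real"
    "integrable (measure_pmf W) (\<lambda>w. (case_option (1/2) real w)\<^sup>2)"
    "measure_pmf.expectation W (\<lambda>w. (case_option (1/2) real w)\<^sup>2)
       \<le> measure_pmf.expectation D (\<lambda>k. (real k)\<^sup>2) + 1"
proof -
  \<comment> \<open>\<open>r k\<close> is the conditional probability of turning the value \<open>k\<close> into \<open>None\<close>.\<close>
  define r where "r k = (if k \<le> 1 then q / 2 / pmf D k else 0)" for k :: nat
  have kcases: "k = 0 \<or> k = 1 \<or> 1 < k" for k :: nat by linarith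
  have qk: "q \<le> pmf D k" if "k \<le> 1" for k using kcases[of k] q that by auto
  have r01: "0 \<le> r k" "r k \<le> 1" for k
    using q(1) qk[of k] by (auto simp: r_def field_simps)
  have rD: "r k * pmf D k = (if k \<le> 1 then q / 2 else 0)" for k
    using q(1) qk[of k] by (auto simp: r_def)
  have r0: "r k = 0" if "k > 1" for k using that by (simp add: r_def)
  have int: "integrable (measure_pmf D) real"
    by (rule measure_pmf.square_integrable_imp_integrable[OF _ int2]) simp
  define W where "W = bind_pmf D (\<lambda>k. map_pmf (\<lambda>c. if c then None else Some k) (bernoulli_pmf (r k)))"
  have nnW: "(\<integral>\<^sup>+w. ennreal (F w) \<partial>measure_pmf W)
      = (\<integral>\<^sup>+k. ennreal (r k * F None + (1 - r k) * F (Some k)) \<partial>measure_pmf D)"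
    if F: "\<And>w. F w \<ge> 0" for F
    unfolding W_def nn_integral_bind_pmf nn_integral_map_pmf
    using r01 F by (intro nn_integral_cong)
      (simp add: nn_integral_bernoulli_pmf ennreal_mult[symmetric] ennreal_plus[symmetric] mult.commute
        del: ennreal_plus)
  have EW: "integrable (measure_pmf W) F \<and> measure_pmf.expectation W F
        = measure_pmf.expectation D (\<lambda>k. r k * F None + (1 - r k) * F (Some k))"
    if F: "\<And>w. F w \<ge> 0"
      and i: "integrable (measure_pmf D) (\<lambda>k. r k * F None + (1 - r k) * F (Some k))" for F
  proof -
    have G0: "0 \<le> r k * F None + (1 - r k) * F (Some k)" for k
      using r01[of k] F by simp
    have "(\<integral>\<^sup>+w. ennreal (F w) \<partial>measure_pmf W)
        = ennreal (measure_pmf.expectation D (\<lambda>k. r k * F None + (1 - r k) * F (Some k)))"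
      unfolding nnW[OF F] using i G0 by (intro nn_integral_eq_integral) auto
    then show ?thesis
      using F G0 by (subst (asm) nn_integral_eq_integrable) auto
  qed
  have fin: "integrable (measure_pmf D) (\<lambda>k. r k * h k) \<and>
      measure_pmf.expectation D (\<lambda>k. r k * h k) = q / 2 * h 0 + q / 2 * h 1" for h
  proof
    show "integrable (measure_pmf D) (\<lambda>k. r k * h k)"
    proof (rule measure_pmf.integrable_const_bound[where B = "\<bar>h 0\<bar> + \<bar>h 1\<bar>"])
      have "\<bar>r k * h k\<bar> \<le> \<bar>h 0\<bar> + \<bar>h 1\<bar>" for k
      proof (cases "k \<le> 1")
        case True
        have "\<bar>r k * h k\<bar> \<le> 1 * \<bar>h k\<bar>"
          unfolding abs_mult using r01[of k] by (intro mult_right_mono) auto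
        also have "\<dots> \<le> \<bar>h 0\<bar> + \<bar>h 1\<bar>" using kcases[of k] True by auto
        finally show ?thesis .
      qed (simp add: r0)
      then show "AE k in measure_pmf D. norm (r k * h k) \<le> \<bar>h 0\<bar> + \<bar>h 1\<bar>" by simp
    qed simp
    have "measure_pmf.expectation D (\<lambda>k. r k * h k) = (\<Sum>k\<in>{0,1}. r k * h k * pmf D k)"
      using kcases r0 by (intro integral_measure_pmf_real) auto
    also have "\<dots> = (\<Sum>k\<in>{0,1}. (r k * pmf D k) * h k)" by (simp add: mult_ac)
    also have "\<dots> = q / 2 * h 0 + q / 2 * h 1" by (simp add: rD)
    finally show "measure_pmf.expectation D (\<lambda>k. r k * h k) = q / 2 * h 0 + q / 2 * h 1" .
  qed
  have Er: "integrable (measure_pmf D) r" "measure_pmf.expectation D r = q"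
    using fin[of "\<lambda>_. 1"] by auto
  show ?thesis
  proof (rule that[of W])
    show "D = bind_pmf W coin_or"
    proof (rule pmf_eqI)
      fix x
      let ?F = "\<lambda>w. pmf (coin_or w) x"
      have eq: "r k * ?F None + (1 - r k) * ?F (Some k)
          = r k * pmf coin x + (of_bool (k = x) - r k * of_bool (k = x))" for k
        by (auto simp: algebra_simps)
      have ind: "integrable (measure_pmf D) (\<lambda>k. of_bool (k = x) :: real)"
        by (rule measure_pmf.integrable_const_bound[where B = 1]) auto
      have indE: "measure_pmf.expectation D (\<lambda>k. of_bool (k = x)) = pmf D x"
        by (subst integral_measure_pmf_real[of "{x}"]) auto
      have "pmf (bind_pmf W coin_or) x = measure_pmf.expectation W ?F" by (rule pmf_bind)
      also have "\<dots> = measure_pmf.expectation D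
          (\<lambda>k. r k * pmf coin x + (of_bool (k = x) - r k * of_bool (k = x)))"
        using EW[of ?F] ind fin[of "\<lambda>k. of_bool (k = x)"] fin[of "\<lambda>k. pmf coin x"]
        unfolding eq by simp
      also have "\<dots> = q * pmf coin x + (pmf D x - (q / 2 * of_bool (0 = x) + q / 2 * of_bool (1 = x)))"
        using ind fin[of "\<lambda>k. of_bool (k = x)"] fin[of "\<lambda>k. pmf coin x"]
        by (simp add: indE)
      also have "\<dots> = pmf D x" using kcases[of x] by (auto simp: pmf_coin)
      finally show "pmf D x = pmf (bind_pmf W coin_or) x" ..
    qed
    show "measure_pmf.expectation W (\<lambda>w. of_bool (w = None)) = q"
      using EW[of "\<lambda>w. of_bool (w = None)"] Er by simp
    have u1: "r k * (1/2) + (1 - r k) * real k = real k + r k * (1/2 - real k)" for k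
      by (simp add: algebra_simps)
    show "measure_pmf.expectation W (case_option (1/2) real) = measure_pmf.expectation D real"
      using EW[of "case_option (1/2) real"] fin[of "\<lambda>k. 1/2 - real k"] int
      unfolding option.case u1 by (simp split: option.split)
    have u2: "r k * (1/2)\<^sup>2 + (1 - r k) * (real k)\<^sup>2 = (real k)\<^sup>2 + r k * (1/4 - (real k)\<^sup>2)" for k
      by (simp add: algebra_simps power2_eq_square)
    note * = EW[of "\<lambda>w. (case_option (1/2) real w)\<^sup>2", unfolded option.case u2]
    have **: "integrable (measure_pmf D) (\<lambda>k. (real k)\<^sup>2 + r k * (1/4 - (real k)\<^sup>2))"
      using fin[of "\<lambda>k. 1/4 - (real k)\<^sup>2"] int2 by simp
    show "integrable (measure_pmf W) (\<lambda>w. (case_option (1/2) real w)\<^sup>2)"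
      using * ** by simp
    have "q \<le> 1" using q(2) pmf_le_1[of D 0] by linarith
    then show "measure_pmf.expectation W (\<lambda>w. (case_option (1/2) real w)\<^sup>2)
       \<le> measure_pmf.expectation D (\<lambda>k. (real k)\<^sup>2) + 1"
      using * ** fin[of "\<lambda>k. 1/4 - (real k)\<^sup>2"] int2 q(1) by simp
  qed
qed

section \<open>The probability that a sum equals its mean\<close>

text \<open>
  If the sum with undecided coins replaced by their means is within \<open>A \<surd>J\<close> of \<open>n\<close>, then \<open>n\<close> is a
  value near the middle of the shifted binomial law of the sum.
\<close>
lemma pmf_sum_coin_or_ge:
  fixes A :: real
  assumes fin: "finite I" and A: "A \<ge> 0"
    and J: "J = card {j \<in> I. w j = None}" "real J \<ge> 64 * A\<^sup>2 + 1"
    and dev: "\<bar>(\<Sum>j\<in>I. case_option (1/2) real (w j)) - real n\<bar> \<le> A * sqrt (real J)"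
  shows "exp (- 8 * A\<^sup>2) / 2 / sqrt (real J)
    \<le> pmf (map_pmf (\<lambda>x. \<Sum>j\<in>I. x j) (Pi_pmf I 0 (\<lambda>j. coin_or (w j)))) n"
proof -
  define T where "T = (\<Sum>j\<in>I. case_option 0 id (w j))"
  have "(\<Sum>j\<in>I. case_option (1/2) real (w j))
      = (\<Sum>j\<in>I. (if w j = None then 1/2 else 0) + real (case_option 0 id (w j)))"
    by (intro sum.cong) (auto split: option.split)
  also have "\<dots> = real J / 2 + real T"
    using fin by (simp add: sum.distrib T_def J(1) sum.If_cases Int_def)
  finally have U: "(\<Sum>j\<in>I. case_option (1/2) real (w j)) = real J / 2 + real T" .
  have "64 * A\<^sup>2 \<le> real J" using J(2) by simp
  then have "sqrt (64 * A\<^sup>2) \<le> sqrt (real J)" by (rule real_sqrt_le_mono)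
  then have sA: "8 * A \<le> sqrt (real J)" using A by (simp add: real_sqrt_mult)
  then have AJ: "8 * (A * sqrt (real J)) \<le> real J"
    using mult_right_mono[OF sA, of "sqrt (real J)"] by simp
  have Tn: "T \<le> n" using dev AJ unfolding U by linarith
  have "\<bar>real (n - T) - real J / 2\<bar> \<le> A * sqrt (real J)"
    using dev Tn unfolding U by (simp add: of_nat_diff abs_minus_commute algebra_simps)
  note b = binomial_near_middle_ge[OF A J(2) this]
  have "pmf (map_pmf (\<lambda>h. h + T) (binomial_pmf J (1/2))) ((n - T) + T)
      = pmf (binomial_pmf J (1/2)) (n - T)"
    by (rule pmf_map_inj') (simp add: inj_def)
  also have "\<dots> = real (J choose (n - T)) / 2 ^ J"
  proof (cases "n - T \<le> J")
    case True
    then show ?thesis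
      by (simp add: power_divide power_add[symmetric] flip: power_mult_distrib)
  qed (simp add: binomial_eq_0)
  finally show ?thesis
    using b Tn unfolding sum_coin_or[OF fin] J(1)[symmetric] T_def[symmetric] by simp
qed

text \<open>
  This is the lower half of a local limit theorem, uniform over a class of laws. Given the
  decided values, by Chebyshev's inequality the conditional mean of the sum is within \<open>O(\<surd>N)\<close> of
  \<open>n\<close> and about \<open>q N\<close> coins are left, with probability at least \<open>1/2\<close>; the coins then hit \<open>n\<close> with
  probability of order \<open>1 / \<surd>N\<close>. The lower bound \<open>q\<close> on the probabilities of \<open>0\<close> and \<open>1\<close> rules
  out laws living on a proper sublattice.
\<close>
lemma prob_sum_eq_mean_ge:
  fixes q V :: real
  assumes q: "q > 0" and V: "V \<ge> 0"
  obtains c N0 where "c > 0"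
    "\<And>(D :: nat pmf) N n. \<lbrakk>q \<le> pmf D 0; q \<le> pmf D 1; integrable (measure_pmf D) (\<lambda>k. (real k)\<^sup>2);
       measure_pmf.expectation D (\<lambda>k. (real k)\<^sup>2) \<le> V; N \<ge> N0;
       real n = real N * measure_pmf.expectation D real\<rbrakk>
     \<Longrightarrow> c / sqrt (real N) \<le> measure_pmf.prob (Pi_pmf {1..N} 0 (\<lambda>_. D)) {x. (\<Sum>j=1..N. x j) = n}"
proof -
  \<comment> \<open>With \<open>J \<ge> N q / 2\<close> coins, the deviation \<open>2 \<surd>(V + 1) \<surd>N\<close>, which Chebyshev's inequality allows
    except with probability \<open>1/4\<close>, is at most \<open>A \<surd>J\<close>. The two summands in \<open>N0\<close> make \<open>J\<close>
    concentrate and make it large enough for the binomial estimate.\<close>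
  define A where "A = 2 * sqrt (V + 1) * sqrt (2 / q)"
  define N0 where "N0 = nat \<lceil>16 / q\<^sup>2 + 2 * (64 * A\<^sup>2 + 1) / q\<rceil>"
  define c0 where "c0 = exp (- 8 * A\<^sup>2) / 2"
  have A0: "A \<ge> 0" using q V by (simp add: A_def)
  show ?thesis
  proof (rule that[of "c0 / 2" N0])
    show "c0 / 2 > 0" by (simp add: c0_def)
    fix D :: "nat pmf" and N n
    assume D0: "q \<le> pmf D 0" and D1: "q \<le> pmf D 1"
      and int2: "integrable (measure_pmf D) (\<lambda>k. (real k)\<^sup>2)"
      and DV: "measure_pmf.expectation D (\<lambda>k. (real k)\<^sup>2) \<le> V" and N: "N \<ge> N0"
      and n: "real n = real N * measure_pmf.expectation D real"
    have "real N \<ge> 16 / q\<^sup>2 + 2 * (64 * A\<^sup>2 + 1) / q"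
      using N unfolding N0_def by linarith
    moreover have "16 / q\<^sup>2 > 0" "2 * (64 * A\<^sup>2 + 1) / q > 0"
      using q zero_le_power2[of A] by (auto intro!: divide_pos_pos mult_pos_pos add_nonneg_pos)
    ultimately have N1: "real N \<ge> 16 / q\<^sup>2" and N2: "real N \<ge> 2 * (64 * A\<^sup>2 + 1) / q" and Npos: "real N > 0"
      by linarith+
    obtain W where W: "D = bind_pmf W coin_or"
      "measure_pmf.expectation W (\<lambda>w. of_bool (w = None)) = q"
      "measure_pmf.expectation W (case_option (1/2) real) = measure_pmf.expectation D real"
      "integrable (measure_pmf W) (\<lambda>w. (case_option (1/2) real w)\<^sup>2)"
      "measure_pmf.expectation W (\<lambda>w. (case_option (1/2) real w)\<^sup>2)
         \<le> measure_pmf.expectation D (\<lambda>k. (real k)\<^sup>2) + 1"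
      using coin_mixture[OF q D0 D1 int2] by blast
    let ?WW = "Pi_pmf {1..N} None (\<lambda>_. W)"
    \<comment> \<open>\<open>J\<close> is the number of undecided coins, and \<open>U\<close> the conditional mean of the sum given \<open>w\<close>.\<close>
    define J where "J w = card {j \<in> {1..N}. w j = None}" for w :: "nat \<Rightarrow> nat option"
    define U where "U w = (\<Sum>j=1..N. case_option (1/2) real (w j))" for w :: "nat \<Rightarrow> nat option"
    define a where "a = 2 * sqrt (V + 1) * sqrt (real N)"
    have a0: "a > 0" using V Npos by (simp add: a_def)
    have Jsum: "real (J w) = (\<Sum>j=1..N. of_bool (w j = None))" for w
      by (simp add: J_def of_bool_def sum.If_cases Int_def)
    have PJ: "measure_pmf.prob ?WW {w. \<bar>real (J w) - real N * q\<bar> \<ge> real N * q / 2} \<le> 1/4"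
    proof -
      have "measure_pmf.prob ?WW {w. \<bar>(\<Sum>j=1..N. of_bool (w j = None)) - real (card {1..N}) * q\<bar> \<ge> real N * q / 2}
          \<le> real (card {1..N}) * 1 / (real N * q / 2)\<^sup>2"
      proof (rule Chebyshev_Pi_pmf[where g = "\<lambda>w. of_bool (w = None)", OF _ _ W(2)])
        show "integrable (measure_pmf W) (\<lambda>x. (of_bool (x = None) :: real)\<^sup>2)"
          by (rule measure_pmf.integrable_const_bound[where B = 1]) auto
        have "(\<lambda>x :: nat option. (of_bool (x = None) :: real)\<^sup>2) = (\<lambda>x. of_bool (x = None))"
          by auto
        moreover have "q \<le> 1" using D0 pmf_le_1[of D 0] by linarith
        ultimately show "measure_pmf.expectation W (\<lambda>x. (of_bool (x = None) :: real)\<^sup>2) \<le> 1"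
          using W(2) by simp
      qed (use q Npos in auto)
      also have "\<dots> = 4 / q\<^sup>2 / real N"
        using Npos by (simp add: power2_eq_square field_simps)
      also have "\<dots> \<le> 1/4"
        using N1 Npos q by (simp add: field_simps)
      finally show ?thesis unfolding Jsum by simp
    qed
    have PU: "measure_pmf.prob ?WW {w. \<bar>U w - real n\<bar> \<ge> a} \<le> 1/4"
    proof -
      have "measure_pmf.prob ?WW {w. \<bar>U w - real n\<bar> \<ge> a} \<le> real (card {1..N}) * (V + 1) / a\<^sup>2"
        unfolding U_def n using Chebyshev_Pi_pmf[OF _ W(4) W(3), of "{1..N}" "V + 1" a None] W(5) DV a0
        by simp
      also have "\<dots> = 1/4"
        using V Npos by (simp add: a_def power_mult_distrib)
      finally show ?thesis .
    qed
    define good where "good = {w. \<bar>real (J w) - real N * q\<bar> < real N * q / 2 \<and> \<bar>U w - real n\<bar> < a}"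
    have "1 - measure_pmf.prob ?WW good = measure_pmf.prob ?WW (- good)"
      using measure_pmf.prob_compl[of good ?WW] by (simp add: Compl_eq_Diff_UNIV)
    also have "- good = {w. \<bar>real (J w) - real N * q\<bar> \<ge> real N * q / 2} \<union> {w. \<bar>U w - real n\<bar> \<ge> a}"
      by (auto simp: good_def)
    also have "measure_pmf.prob ?WW \<dots> \<le> 1/4 + 1/4"
      by (rule order_trans[OF measure_Un_le add_mono[OF PJ PU]]) auto
    finally have Pgood: "measure_pmf.prob ?WW good \<ge> 1/2" by simp
    let ?Q = "\<lambda>w. map_pmf (\<lambda>x. \<Sum>j=1..N. x j) (Pi_pmf {1..N} 0 (\<lambda>j. coin_or (w j)))"
    have Qgood: "c0 / sqrt (real N) * indicator good w \<le> pmf (?Q w) n" for w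
    proof (cases "w \<in> good")
      case True
      then have g: "\<bar>real (J w) - real N * q\<bar> < real N * q / 2" "\<bar>U w - real n\<bar> < a"
        by (auto simp: good_def)
      have Jge: "real (J w) \<ge> real N * q / 2" using g(1) by linarith
      have "J w \<le> card {1..N}" unfolding J_def by (intro card_mono) auto
      then have JN: "J w \<le> N" by simp
      have "64 * A\<^sup>2 + 1 \<le> real N * q / 2" using N2 q by (simp add: field_simps)
      then have J2: "real (J w) \<ge> 64 * A\<^sup>2 + 1" using Jge by linarith
      have "real N \<le> 2 / q * real (J w)" using Jge q by (simp add: field_simps)
      then have "sqrt (real N) \<le> sqrt (2 / q) * sqrt (real (J w))"
        by (metis real_sqrt_le_iff real_sqrt_mult)
      then have "a \<le> A * sqrt (real (J w))"
        unfolding a_def A_def mult.assoc using V by (intro mult_left_mono) auto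
      then have dev: "\<bar>(\<Sum>j=1..N. case_option (1/2) real (w j)) - real n\<bar> \<le> A * sqrt (real (J w))"
        using g(2) unfolding U_def by linarith
      have "0 < real (J w)" using J2 zero_le_power2[of A] by linarith
      then have "c0 / sqrt (real N) \<le> c0 / sqrt (real (J w))"
        using JN by (intro divide_left_mono) (auto simp: c0_def)
      also have "\<dots> \<le> pmf (?Q w) n"
        using pmf_sum_coin_or_ge[OF _ A0 J_def J2 dev] by (simp add: c0_def)
      finally show ?thesis using True by simp
    qed simp
    have "c0 / 2 / sqrt (real N) \<le> c0 / sqrt (real N) * measure_pmf.prob ?WW good"
      using mult_left_mono[OF Pgood, of "c0 / sqrt (real N)"] by (simp add: c0_def)
    also have "\<dots> = measure_pmf.expectation ?WW (\<lambda>w. c0 / sqrt (real N) * indicator good w)"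
      by simp
    also have "\<dots> \<le> measure_pmf.expectation ?WW (\<lambda>w. pmf (?Q w) n)"
      using Qgood by (intro integral_mono measure_pmf.integrable_const_bound[where B = 1]
          integrable_mult_right) (auto simp: pmf_le_1 integrable_measure_pmf_finite)
    also have "\<dots> = pmf (map_pmf (\<lambda>x. \<Sum>j=1..N. x j) (Pi_pmf {1..N} 0 (\<lambda>_. D))) n"
      unfolding W(1) Pi_pmf_bind[OF finite_atLeastAtMost, of 1 N 0 "\<lambda>_. W" "\<lambda>_. coin_or" None] map_bind_pmf
      by (rule pmf_bind[symmetric])
    also have "\<dots> = measure_pmf.prob (Pi_pmf {1..N} 0 (\<lambda>_. D)) {x. (\<Sum>j=1..N. x j) = n}"
      by (simp add: pmf_map vimage_def)
    finally show "c0 / 2 / sqrt (real N) \<le> measure_pmf.prob (Pi_pmf {1..N} 0 (\<lambda>_. D)) {x. (\<Sum>j=1..N. x j) = n}" .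
  qed
qed

section \<open>A Bernstein inequality\<close>

lemma exp_le_quadratic:
  fixes x :: real
  assumes "\<bar>x\<bar> \<le> 1"
  shows "exp x \<le> 1 + x + x\<^sup>2"
proof (cases "x \<ge> 0")
  case True
  then show ?thesis using exp_bound[of x] assms by simp
next
  case False
  define y where "y = - x"
  have y: "y > 0" using False by (simp add: y_def)
  have "1 * 1 \<le> (1 - y + y\<^sup>2) * (1 + y + y\<^sup>2 / 2)"
  proof -
    have "(1 - y + y\<^sup>2) * (1 + y + y\<^sup>2 / 2) = 1 + y\<^sup>2 / 2 + y ^ 3 / 2 + y ^ 4 / 2"
      by (simp add: field_simps power2_eq_square power3_eq_cube power4_eq_xxxx)
    then show ?thesis using y by simp
  qed
  also have "\<dots> \<le> (1 - y + y\<^sup>2) * exp y"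
  proof (rule mult_left_mono)
    show "1 + y + y\<^sup>2 / 2 \<le> exp y" using exp_lower_Taylor_quadratic[of y] y by simp
    show "0 \<le> 1 - y + y\<^sup>2" using assms by (simp add: y_def)
  qed
  finally have "exp (- y) \<le> 1 - y + y\<^sup>2"
    by (simp add: exp_minus field_simps)
  then show ?thesis by (simp add: y_def)
qed

text \<open>
  By \<open>exp x \<le> 1 + x + x\<^sup>2\<close> the moment generating function of a centred bounded variable at
  \<open>l \<le> 1\<close> is at most \<open>exp (l\<^sup>2 v)\<close>. For \<open>n\<close> summands, \<open>2 l n v\<close> is the threshold for which \<open>l\<close> is
  the best exponent, and Markov's inequality for \<open>exp (l S)\<close> there leaves \<open>exp (- l\<^sup>2 n v)\<close>.
\<close>
lemma Bernstein_upper_Pi_pmf: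
  fixes g :: "'a \<Rightarrow> real" and A :: "'i set"
  assumes fin: "finite A" and bound: "\<And>y. \<bar>g y\<bar> \<le> 1"
    and mean: "measure_pmf.expectation W g = 0"
    and var: "measure_pmf.expectation W (\<lambda>y. (g y)\<^sup>2) = v" and l: "0 \<le> l" "l \<le> 1"
  shows "measure_pmf.prob (Pi_pmf A d (\<lambda>_. W)) {x. (\<Sum>i\<in>A. g (x i)) \<ge> 2 * l * real (card A) * v}
     \<le> exp (- (l\<^sup>2 * real (card A) * v))"
proof -
  let ?P = "Pi_pmf A d (\<lambda>_. W)"
  have lg: "\<bar>l * g y\<bar> \<le> 1" for y
    unfolding abs_mult using mult_mono[of "\<bar>l\<bar>" 1 "\<bar>g y\<bar>" 1] l bound[of y] by simp
  have int: "integrable (measure_pmf W) g" "integrable (measure_pmf W) (\<lambda>y. (g y)\<^sup>2)"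
    using bound by (auto intro!: measure_pmf.integrable_const_bound[where B = 1] simp: abs_square_le_1)
  have int_exp: "integrable (measure_pmf W) (\<lambda>y. exp (l * g y))"
    using abs_le_D1[OF lg] by (intro measure_pmf.integrable_const_bound[where B = "exp 1"]) auto
  have "measure_pmf.expectation W (\<lambda>y. exp (l * g y))
      \<le> measure_pmf.expectation W (\<lambda>y. 1 + l * g y + l\<^sup>2 * (g y)\<^sup>2)"
    using int int_exp exp_le_quadratic[OF lg]
    by (intro integral_mono) (auto simp: power_mult_distrib)
  also have "\<dots> = 1 + l\<^sup>2 * v" using int mean var by simp
  also have "\<dots> \<le> exp (l\<^sup>2 * v)" by (rule exp_ge_add_one_self)
  finally have mgf: "measure_pmf.expectation W (\<lambda>y. exp (l * g y)) \<le> exp (l\<^sup>2 * v)" .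
  have e: "exp (l * (\<Sum>i\<in>A. g (x i))) = (\<Prod>i\<in>A. exp (l * g (x i)))" for x
    by (simp add: sum_distrib_left exp_sum fin)
  have "measure_pmf.expectation ?P (\<lambda>x. exp (l * (\<Sum>i\<in>A. g (x i))))
      = (\<Prod>i\<in>A. measure_pmf.expectation W (\<lambda>y. exp (l * g y)))"
    unfolding e using int_exp by (intro expectation_prod_Pi_pmf fin) auto
  also have "\<dots> \<le> exp (l\<^sup>2 * v) ^ card A"
    using mgf by (simp add: power_mono)
  also have "\<dots> = exp (l\<^sup>2 * real (card A) * v)"
    by (simp add: exp_of_nat_mult[symmetric] mult_ac)
  finally have mgf_sum: "measure_pmf.expectation ?P (\<lambda>x. exp (l * (\<Sum>i\<in>A. g (x i))))
      \<le> exp (l\<^sup>2 * real (card A) * v)" .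
  have int_sum: "integrable (measure_pmf ?P) (\<lambda>x. exp (l * (\<Sum>i\<in>A. g (x i))))"
    unfolding e using int_exp by (intro integrable_prod_Pi_pmf fin) auto
  have "measure_pmf.prob ?P {x. (\<Sum>i\<in>A. g (x i)) \<ge> 2 * l * real (card A) * v}
      \<le> measure_pmf.prob ?P {x. exp (l * (\<Sum>i\<in>A. g (x i))) \<ge> exp (2 * l\<^sup>2 * real (card A) * v)}"
  proof (rule measure_pmf.finite_measure_mono)
    have "l * S \<ge> 2 * l\<^sup>2 * real (card A) * v" if "S \<ge> 2 * l * real (card A) * v" for S
      using mult_left_mono[OF that l(1)] by (simp add: power2_eq_square mult_ac)
    then show "{x. (\<Sum>i\<in>A. g (x i)) \<ge> 2 * l * real (card A) * v}
       \<subseteq> {x. exp (l * (\<Sum>i\<in>A. g (x i))) \<ge> exp (2 * l\<^sup>2 * real (card A) * v)}" by auto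
  qed simp
  also have "\<dots> \<le> measure_pmf.expectation ?P (\<lambda>x. exp (l * (\<Sum>i\<in>A. g (x i))))
      / exp (2 * l\<^sup>2 * real (card A) * v)"
    using integral_Markov_inequality_measure[OF int_sum, of "{}" "exp (2 * l\<^sup>2 * real (card A) * v)"]
    by simp
  also have "\<dots> \<le> exp (l\<^sup>2 * real (card A) * v) / exp (2 * l\<^sup>2 * real (card A) * v)"
    by (rule divide_right_mono[OF mgf_sum]) simp
  also have "\<dots> = exp (- (l\<^sup>2 * real (card A) * v))"
    by (simp add: exp_diff[symmetric])
  finally show ?thesis .
qed

lemma Bernstein_Pi_pmf:
  fixes f :: "'a \<Rightarrow> real" and A :: "'i set"
  assumes fin: "finite A" and bound: "\<And>y. \<bar>f y - m\<bar> \<le> 1"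
    and mean: "measure_pmf.expectation W f = m"
    and var: "measure_pmf.expectation W (\<lambda>y. (f y - m)\<^sup>2) = v" and l: "0 \<le> l" "l \<le> 1"
  shows "measure_pmf.prob (Pi_pmf A d (\<lambda>_. W))
       {x. \<bar>(\<Sum>i\<in>A. f (x i)) - real (card A) * m\<bar> \<ge> 2 * l * real (card A) * v}
     \<le> 2 * exp (- (l\<^sup>2 * real (card A) * v))"
proof -
  let ?P = "measure_pmf.prob (Pi_pmf A d (\<lambda>_. W))"
  let ?r = "2 * l * real (card A) * v"
  have le_abs: "r \<le> \<bar>z\<bar> \<longleftrightarrow> r \<le> z \<or> r \<le> - z" for r z :: real
    by linarith
  have "\<bar>f y\<bar> \<le> 1 + \<bar>m\<bar>" for y using bound[of y] by linarith
  then have int: "integrable (measure_pmf W) f"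
    by (intro measure_pmf.integrable_const_bound[where B = "1 + \<bar>m\<bar>"]) auto
  have up: "?P {x. (\<Sum>i\<in>A. f (x i) - m) \<ge> ?r} \<le> exp (- (l\<^sup>2 * real (card A) * v))"
    by (rule Bernstein_upper_Pi_pmf[OF fin bound _ var l]) (use int mean in simp)
  have bound': "\<bar>m - f y\<bar> \<le> 1" for y using bound[of y] by linarith
  have var': "measure_pmf.expectation W (\<lambda>y. (m - f y)\<^sup>2) = v"
    using var by (subst power2_commute)
  have lo: "?P {x. (\<Sum>i\<in>A. m - f (x i)) \<ge> ?r} \<le> exp (- (l\<^sup>2 * real (card A) * v))"
    by (rule Bernstein_upper_Pi_pmf[OF fin bound' _ var' l]) (use int mean in simp)
  have split: "{x. \<bar>(\<Sum>i\<in>A. f (x i)) - real (card A) * m\<bar> \<ge> ?r}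
      = {x. (\<Sum>i\<in>A. f (x i) - m) \<ge> ?r} \<union> {x. (\<Sum>i\<in>A. m - f (x i)) \<ge> ?r}"
    unfolding sum_subtractf sum_constant by (simp only: le_abs minus_diff_eq Collect_disj_eq)
  show ?thesis
    unfolding split by (rule order_trans[OF measure_Un_le order_trans[OF add_mono[OF up lo]]]) simp_all
qed

section \<open>Products of product laws and the conditional law of one colour\<close>

text \<open>
  The scheme is given colour by colour, each colour being independent over the boxes. Read box
  by box, the same matrix law makes the boxes independent.
\<close>
lemma Pi_pmf_transpose:
  fixes p :: "'a \<Rightarrow> 'b \<Rightarrow> 'c pmf"
  assumes fin: "finite A" "finite B"
  shows "map_pmf (\<lambda>x j i. x i j) (Pi_pmf A (\<lambda>_. d) (\<lambda>i. Pi_pmf B d (p i)))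
    = Pi_pmf B (\<lambda>_. d) (\<lambda>j. Pi_pmf A d (\<lambda>i. p i j))"
proof (rule pmf_eqI)
  fix f
  let ?T = "\<lambda>(x :: 'a \<Rightarrow> 'b \<Rightarrow> 'c) j i. x i j"
  have pmf_nested: "pmf (Pi_pmf A (\<lambda>_. d) (\<lambda>i. Pi_pmf B d (p i))) g
      = (if \<forall>i j. i \<notin> A \<or> j \<notin> B \<longrightarrow> g i j = d then \<Prod>i\<in>A. \<Prod>j\<in>B. pmf (p i j) (g i j) else 0)"
    if "finite A" "finite B" for A :: "'x set" and B :: "'y set" and g
      and p :: "'x \<Rightarrow> 'y \<Rightarrow> 'c pmf"
    using that by (auto simp: pmf_Pi fun_eq_iff intro!: prod.cong)
  have "pmf (map_pmf ?T (Pi_pmf A (\<lambda>_. d) (\<lambda>i. Pi_pmf B d (p i)))) (?T (\<lambda>i j. f j i))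
      = pmf (Pi_pmf A (\<lambda>_. d) (\<lambda>i. Pi_pmf B d (p i))) (\<lambda>i j. f j i)"
    by (rule pmf_map_inj') (auto simp: inj_def fun_eq_iff)
  also have "\<dots> = pmf (Pi_pmf B (\<lambda>_. d) (\<lambda>j. Pi_pmf A d (\<lambda>i. p i j))) f"
    unfolding pmf_nested[OF fin] pmf_nested[OF fin(2,1)] by (subst prod.swap) auto
  finally show "pmf (map_pmf ?T (Pi_pmf A (\<lambda>_. d) (\<lambda>i. Pi_pmf B d (p i)))) f
      = pmf (Pi_pmf B (\<lambda>_. d) (\<lambda>j. Pi_pmf A d (\<lambda>i. p i j))) f" by simp
qed

text \<open>
  The ways to put \<open>n\<close> balls into the boxes \<open>1, \<dots>, N\<close>, as functions with the value \<open>0\<close> outside the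
  range of boxes, which is the default value in \<^const>\<open>xi_sample\<close>. The upper bound \<open>n\<close> on
  the entries is implied by the sum; it makes finiteness evident.
\<close>
definition fillings :: "nat \<Rightarrow> nat \<Rightarrow> (nat \<Rightarrow> nat) set" where
  "fillings N n = {x \<in> PiE_dflt {1..N} 0 (\<lambda>_. {0..n}). (\<Sum>j=1..N. x j) = n}"

lemma finite_fillings: "finite (fillings N n)"
  unfolding fillings_def
  by (rule finite_subset[of _ "PiE_dflt {1..N} 0 (\<lambda>_. {0..n})"]) (auto simp: finite_PiE_dflt)

lemma fillings_eq: "fillings N n = {x. (\<forall>j. j \<notin> {1..N} \<longrightarrow> x j = 0) \<and> (\<Sum>j=1..N. x j) = n}"
proof -
  have "x j \<le> n" if "(\<Sum>j=1..N. x j) = n" "j \<in> {1..N}" for x :: "nat \<Rightarrow> nat" and j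
    using member_le_sum[of j "{1..N}" x] that by simp
  then show ?thesis unfolding fillings_def PiE_dflt_def by auto
qed

text \<open>
  The parameter enters only through a factor that depends on the total number of balls. This is
  why it cancels after conditioning on that number.
\<close>
lemma pmf_xi_sample:
  assumes b: "\<And>k. b k \<ge> 0" "b 0 > 0" "\<theta> \<in> params b"
  shows "(\<Prod>j=1..N. pmf (xi_pmf b \<theta>) (k j))
    = (\<Prod>j=1..N. b (k j) / fact (k j)) * (\<theta> ^ (\<Sum>j=1..N. k j) / gen_fun b \<theta> ^ N)"
  unfolding pmf_xi_pmf[OF b] by (simp add: prod_dividef prod.distrib power_sum)

lemma prob_xi_sample_sum:
  assumes b: "\<And>k. b k \<ge> 0" "b 0 > 0" "\<theta> \<in> params b"
  shows "measure_pmf.prob (xi_sample b \<theta> N) {x. (\<Sum>j=1..N. x j) = n}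
    = (\<Sum>x\<in>fillings N n. \<Prod>j=1..N. b (x j) / fact (x j)) * (\<theta> ^ n / gen_fun b \<theta> ^ N)"
proof -
  have "measure_pmf.prob (xi_sample b \<theta> N) {x. (\<Sum>j=1..N. x j) = n}
      = measure_pmf.prob (xi_sample b \<theta> N) (fillings N n)"
    by (rule measure_prob_cong_0) (auto simp: fillings_eq xi_sample_def pmf_Pi)
  also have "\<dots> = (\<Sum>x\<in>fillings N n. pmf (xi_sample b \<theta> N) x)"
    by (rule measure_measure_pmf_finite[OF finite_fillings])
  also have "\<dots> = (\<Sum>x\<in>fillings N n. \<Prod>j=1..N. pmf (xi_pmf b \<theta>) (x j))"
    by (intro sum.cong refl) (auto simp: xi_sample_def fillings_eq pmf_Pi)
  also have "\<dots> = (\<Sum>x\<in>fillings N n.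
      (\<Prod>j=1..N. b (x j) / fact (x j)) * (\<theta> ^ n / gen_fun b \<theta> ^ N))"
    unfolding pmf_xi_sample[of b, OF b] by (intro sum.cong refl) (simp add: fillings_def)
  finally show ?thesis by (simp only: sum_distrib_right)
qed

lemma cond_prob_xi_sample:
  assumes b: "\<And>k. b k \<ge> 0" "b 0 > 0" "\<theta> \<in> params b" and k: "(\<Sum>j=1..N. k j) = n"
  shows "\<P>(x in xi_sample b \<theta> N. (\<forall>j\<in>{1..N}. x j = k j) \<bar> (\<Sum>j=1..N. x j) = n)
    = (\<Prod>j=1..N. pmf (xi_pmf b \<theta>) (k j)) / measure_pmf.prob (xi_sample b \<theta> N) {x. (\<Sum>j=1..N. x j) = n}"
proof -
  have sum_x: "(\<Sum>j=1..N. x j) = n" if "\<forall>j\<in>{1..N}. x j = k j" for x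
    unfolding k[symmetric] using that by (intro sum.cong) auto
  have eq: "(\<forall>j\<in>{1..N}. x j = k j) \<and> (\<Sum>j=1..N. x j) = n \<longleftrightarrow> x \<in> Pi {1..N} (\<lambda>j. {k j})" for x
    using sum_x[of x] unfolding Pi_iff singleton_iff by blast
  have "measure_pmf.prob (xi_sample b \<theta> N) (Pi {1..N} (\<lambda>j. {k j})) = (\<Prod>j=1..N. pmf (xi_pmf b \<theta>) (k j))"
    unfolding xi_sample_def by (subst measure_Pi_pmf_Pi) (auto simp: measure_pmf_single)
  then show ?thesis
    unfolding cond_prob_def by (simp only: eq space_measure_pmf UNIV_I simp_thms Collect_mem_eq)
qed

lemma cond_prob_xi_sample_cong:
  assumes b: "\<And>k. b k \<ge> 0" "b 0 > 0" and \<theta>: "\<theta> \<in> params b" "\<theta>' \<in> params b"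
    and k: "(\<Sum>j=1..N. k j) = n"
  shows "\<P>(x in xi_sample b \<theta> N. (\<forall>j\<in>{1..N}. x j = k j) \<bar> (\<Sum>j=1..N. x j) = n)
    = \<P>(x in xi_sample b \<theta>' N. (\<forall>j\<in>{1..N}. x j = k j) \<bar> (\<Sum>j=1..N. x j) = n)"
proof -
  have "gen_fun b t \<noteq> 0" "t \<noteq> 0" if t: "t \<in> params b" for t
  proof -
    show "t \<noteq> 0" using t by (auto simp: params_def)
    show "gen_fun b t \<noteq> 0"
    proof
      assume 0: "gen_fun b t = 0"
      have "pmf (xi_pmf b t) k = 0" for k
        unfolding pmf_xi_pmf[of b, OF b t] 0 by simp
      then show False using set_pmf_not_empty[of "xi_pmf b t"] by (auto simp: set_pmf_eq)
    qed
  qed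
  then have cancel: "\<theta> ^ n / gen_fun b \<theta> ^ N \<noteq> 0" "\<theta>' ^ n / gen_fun b \<theta>' ^ N \<noteq> 0"
    using \<theta> by auto
  show ?thesis
    unfolding cond_prob_xi_sample[of b, OF b \<theta>(1) k] cond_prob_xi_sample[of b, OF b \<theta>(2) k]
      prob_xi_sample_sum[of b, OF b \<theta>(1)] prob_xi_sample_sum[of b, OF b \<theta>(2)]
      pmf_xi_sample[of b, OF b \<theta>(1)] pmf_xi_sample[of b, OF b \<theta>(2)] k
    by (simp only: mult_divide_mult_cancel_right[OF cancel(1)] mult_divide_mult_cancel_right[OF cancel(2)])
qed

section \<open>From the allocation scheme to independent boxes\<close>

text \<open>
  Conditioning on an event divides probabilities at most by the probability of that event. The
  matrix is cut off to the range of colours and boxes because nothing is known about \<open>\<eta>\<close> outside it.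
  
  The scheme specifies only the probabilities of single matrices with the right sums. The bound is
  therefore obtained from the complement: the good matrices with the right sums already carry the mass
  \<open>1 - Q (F \<inter> Bad) / Z\<close>.
\<close>
lemma allocation_scheme_prob_le:
  assumes M: "prob_space M"
    and meas: "\<And>i j. i \<in> {1..K} \<Longrightarrow> j \<in> {1..N} \<Longrightarrow> \<eta> i j \<in> measurable M (count_space UNIV)"
    and b: "\<And>i k. i \<in> {1..K} \<Longrightarrow> b i k \<ge> 0" "\<And>i. i \<in> {1..K} \<Longrightarrow> b i 0 > 0"
    and \<theta>: "\<And>i. i \<in> {1..K} \<Longrightarrow> \<theta> i \<in> params (b i)"
    and scheme: "allocation_scheme M K b N n \<eta>"
    and pos: "\<And>i. i \<in> {1..K} \<Longrightarrow>
      measure_pmf.prob (xi_sample (b i) (\<theta> i) N) {x. (\<Sum>j=1..N. x j) = n i} > 0"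
  shows "measure M {\<omega> \<in> space M. (\<lambda>i j. if i \<in> {1..K} \<and> j \<in> {1..N} then \<eta> i j \<omega> else 0) \<in> Bad}
    \<le> measure_pmf.prob (Pi_pmf {1..K} (\<lambda>_. 0) (\<lambda>i. xi_sample (b i) (\<theta> i) N)) Bad
       / (\<Prod>i=1..K. measure_pmf.prob (xi_sample (b i) (\<theta> i) N) {x. (\<Sum>j=1..N. x j) = n i})"
proof -
  interpret prob_space M by (rule M)
  let ?Q = "Pi_pmf {1..K} (\<lambda>_. 0) (\<lambda>i. xi_sample (b i) (\<theta> i) N)"
  define y where "y \<omega> = (\<lambda>i j. if i \<in> {1..K} \<and> j \<in> {1..N} then \<eta> i j \<omega> else 0)" for \<omega>
  define Z where "Z = (\<Prod>i=1..K. measure_pmf.prob (xi_sample (b i) (\<theta> i) N) {x. (\<Sum>j=1..N. x j) = n i})"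
  have Z: "Z > 0" unfolding Z_def using pos by (intro prod_pos) auto
  \<comment> \<open>\<open>F\<close> consists of the matrices with the prescribed sums, and \<open>Z\<close> is the mass that the product
    law gives to them.\<close>
  define F where "F = PiE_dflt {1..K} (\<lambda>_. 0) (\<lambda>i. fillings N (n i))"
  have finF: "finite F" unfolding F_def by (rule finite_PiE_dflt) (auto simp: finite_fillings)
  have F_sum: "(\<Sum>j=1..N. k i j) = n i" if "k \<in> F" "i \<in> {1..K}" for k i
    using that unfolding F_def PiE_dflt_def fillings_def by auto
  have F_zero: "k i j = 0" if "k \<in> F" "i \<notin> {1..K} \<or> j \<notin> {1..N}" for k i j
    using that unfolding F_def PiE_dflt_def fillings_eq by (cases "i \<in> {1..K}") auto
  have QF: "measure_pmf.prob ?Q F = Z"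
  proof -
    have "measure_pmf.prob (xi_sample (b i) (\<theta> i) N) (fillings N (n i))
        = measure_pmf.prob (xi_sample (b i) (\<theta> i) N) {x. (\<Sum>j=1..N. x j) = n i}" for i
      by (rule measure_prob_cong_0) (auto simp: fillings_eq xi_sample_def pmf_Pi)
    then show ?thesis unfolding F_def Z_def by (simp add: measure_Pi_pmf_PiE_dflt)
  qed
  define E where "E k = {\<omega> \<in> space M. \<forall>i\<in>{1..K}. \<forall>j\<in>{1..N}. \<eta> i j \<omega> = k i j}" for k
  have E_sets: "E k \<in> events" for k
    unfolding E_def
  proof (intro sets.sets_Collect_finite_All)
    fix i j assume ij: "i \<in> {1..K}" "j \<in> {1..N}"
    have "\<eta> i j -` {k i j} \<inter> space M \<in> events"
      by (rule measurable_sets[OF meas[OF ij]]) simp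
    also have "\<eta> i j -` {k i j} \<inter> space M = {\<omega> \<in> space M. \<eta> i j \<omega> = k i j}" by auto
    finally show "{\<omega> \<in> space M. \<eta> i j \<omega> = k i j} \<in> events" .
  qed auto
  have E_prob: "prob (E k) = pmf ?Q k / Z" if k: "k \<in> F" for k
  proof -
    \<comment> \<open>The scheme may be presented with some other parameter \<open>\<theta>0\<close>.\<close>
    obtain \<theta>0 where \<theta>0: "\<forall>i\<in>{1..K}. \<theta>0 i \<in> params (b i)"
      and eq: "\<And>k. \<forall>i\<in>{1..K}. (\<Sum>j=1..N. k i j) = n i \<Longrightarrow>
           \<P>(\<omega> in M. \<forall>i\<in>{1..K}. \<forall>j\<in>{1..N}. \<eta> i j \<omega> = k i j) =
           (\<Prod>i=1..K. \<P>(x in xi_sample (b i) (\<theta>0 i) N.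
              (\<forall>j\<in>{1..N}. x j = k i j) \<bar> (\<Sum>j=1..N. x j) = n i))"
      using scheme unfolding allocation_scheme_def by blast
    have "prob (E k) = (\<Prod>i=1..K. \<P>(x in xi_sample (b i) (\<theta>0 i) N.
              (\<forall>j\<in>{1..N}. x j = k i j) \<bar> (\<Sum>j=1..N. x j) = n i))"
      unfolding E_def using F_sum[OF k] by (intro eq) blast
    also have "\<dots> = (\<Prod>i=1..K. (\<Prod>j=1..N. pmf (xi_pmf (b i) (\<theta> i)) (k i j))
        / measure_pmf.prob (xi_sample (b i) (\<theta> i) N) {x. (\<Sum>j=1..N. x j) = n i})"
    proof (intro prod.cong refl)
      fix i assume i: "i \<in> {1..K}"
      have "\<P>(x in xi_sample (b i) (\<theta>0 i) N. (\<forall>j\<in>{1..N}. x j = k i j) \<bar> (\<Sum>j=1..N. x j) = n i)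
          = \<P>(x in xi_sample (b i) (\<theta> i) N. (\<forall>j\<in>{1..N}. x j = k i j) \<bar> (\<Sum>j=1..N. x j) = n i)"
        by (rule cond_prob_xi_sample_cong[of "b i", OF b(1)[OF i] b(2)[OF i] \<theta>0[rule_format, OF i] \<theta>[OF i] F_sum[OF k i]])
      also have "\<dots> = (\<Prod>j=1..N. pmf (xi_pmf (b i) (\<theta> i)) (k i j))
        / measure_pmf.prob (xi_sample (b i) (\<theta> i) N) {x. (\<Sum>j=1..N. x j) = n i}"
        by (rule cond_prob_xi_sample[of "b i", OF b(1)[OF i] b(2)[OF i] \<theta>[OF i] F_sum[OF k i]])
      finally show "\<P>(x in xi_sample (b i) (\<theta>0 i) N. (\<forall>j\<in>{1..N}. x j = k i j) \<bar> (\<Sum>j=1..N. x j) = n i)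
        = (\<Prod>j=1..N. pmf (xi_pmf (b i) (\<theta> i)) (k i j))
        / measure_pmf.prob (xi_sample (b i) (\<theta> i) N) {x. (\<Sum>j=1..N. x j) = n i}" .
    qed
    also have "\<dots> = (\<Prod>i=1..K. \<Prod>j=1..N. pmf (xi_pmf (b i) (\<theta> i)) (k i j)) / Z"
      unfolding Z_def by (rule prod_dividef)
    also have "(\<Prod>i=1..K. \<Prod>j=1..N. pmf (xi_pmf (b i) (\<theta> i)) (k i j)) = (\<Prod>i=1..K. pmf (xi_sample (b i) (\<theta> i) N) (k i))"
      unfolding xi_sample_def using F_zero[OF k] by (intro prod.cong refl) (subst pmf_Pi', auto)
    also have "\<dots> = pmf ?Q k"
      using F_zero[OF k] by (subst pmf_Pi') auto
    finally show ?thesis .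
  qed
  have disj: "disjoint_family_on E (F - Bad)"
    unfolding disjoint_family_on_def
  proof (intro ballI impI)
    fix k k' assume kk: "k \<in> F - Bad" "k' \<in> F - Bad" "k \<noteq> k'"
    then obtain i j where ij: "k i j \<noteq> k' i j" by (auto simp: fun_eq_iff)
    then have "i \<in> {1..K}" "j \<in> {1..N}" using F_zero[of k] F_zero[of k'] kk by fastforce+
    then show "E k \<inter> E k' = {}" unfolding E_def using ij by auto
  qed
  have yE: "y \<omega> = k" if k: "k \<in> F" and \<omega>: "\<omega> \<in> E k" for k \<omega>
  proof (intro ext)
    fix i j
    show "y \<omega> i j = k i j" using \<omega> F_zero[OF k, of i j] unfolding y_def E_def by auto
  qed
  have U_sets: "(\<Union>k\<in>F - Bad. E k) \<in> events"
    using E_sets finF by (intro sets.finite_UN) auto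
  have "{\<omega> \<in> space M. y \<omega> \<in> Bad} \<subseteq> space M - (\<Union>k\<in>F - Bad. E k)"
    using yE by blast
  then have "prob {\<omega> \<in> space M. y \<omega> \<in> Bad} \<le> prob (space M - (\<Union>k\<in>F - Bad. E k))"
    using U_sets by (intro finite_measure_mono) auto
  also have "\<dots> = 1 - prob (\<Union>k\<in>F - Bad. E k)"
    by (rule prob_compl[OF U_sets])
  also have "prob (\<Union>k\<in>F - Bad. E k) = (\<Sum>k\<in>F - Bad. prob (E k))"
    using E_sets finF disj by (intro finite_measure_finite_Union) auto
  also have "\<dots> = (\<Sum>k\<in>F - Bad. pmf ?Q k) / Z"
    unfolding sum_divide_distrib using E_prob by (intro sum.cong) auto
  also have "(\<Sum>k\<in>F - Bad. pmf ?Q k) = measure_pmf.prob ?Q (F - Bad)"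
    using finF by (simp add: measure_measure_pmf_finite)
  also have "\<dots> = Z - measure_pmf.prob ?Q (F \<inter> Bad)"
    unfolding QF[symmetric] by (rule measure_pmf.finite_measure_Diff') auto
  also have "1 - (Z - measure_pmf.prob ?Q (F \<inter> Bad)) / Z = measure_pmf.prob ?Q (F \<inter> Bad) / Z"
    using Z by (simp add: field_simps)
  also have "\<dots> \<le> measure_pmf.prob ?Q Bad / Z"
    using Z by (intro divide_right_mono measure_pmf.finite_measure_mono) auto
  finally show ?thesis unfolding y_def Z_def .
qed

text \<open>
  Read box by box, the count is a sum of independent indicators with success probability \<open>p\<close>.
\<close>
lemma box_count_independent_tail:
  fixes s :: "nat \<Rightarrow> nat" and N K :: nat
  assumes p: "p = (\<Prod>i=1..K. pmf (D i) (s i))" and l: "0 \<le> l" "l \<le> 1"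
  shows "measure_pmf.prob (Pi_pmf {1..K} (\<lambda>_. 0) (\<lambda>i. Pi_pmf {1..N} 0 (\<lambda>_. D i)))
     {y. \<bar>(\<Sum>j=1..N. \<Prod>i=1..K. of_bool (y i j = s i)) - real N * p\<bar> \<ge> 2 * l * real N * (p * (1 - p))}
    \<le> 2 * exp (- (l\<^sup>2 * real N * (p * (1 - p))))"
proof -
  let ?Q = "Pi_pmf {1..K} (\<lambda>_. 0) (\<lambda>i. Pi_pmf {1..N} 0 (\<lambda>_. D i))"
  let ?W = "Pi_pmf {1..K} 0 D"
  define f :: "(nat \<Rightarrow> nat) \<Rightarrow> real" where "f y = (\<Prod>i=1..K. of_bool (y i = s i))" for y
  have f01: "f y = of_bool (\<forall>i\<in>{1..K}. y i = s i)" for y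
    by (auto simp: f_def)
  have int: "integrable (measure_pmf ?W) f"
    by (rule measure_pmf.integrable_const_bound[where B = 1]) (auto simp: f01)
  have "measure_pmf.expectation (D i) (\<lambda>x. of_bool (x = s i)) = pmf (D i) (s i)" for i
    by (subst integral_measure_pmf_real[of "{s i}"]) auto
  moreover have "measure_pmf.expectation ?W f = (\<Prod>i=1..K. measure_pmf.expectation (D i) (\<lambda>x. of_bool (x = s i)))"
    unfolding f_def
    by (intro expectation_prod_Pi_pmf) (auto intro!: measure_pmf.integrable_const_bound[where B = 1])
  ultimately have mean: "measure_pmf.expectation ?W f = p" unfolding p by simp
  have p01: "0 \<le> p" "p \<le> 1"
    unfolding p by (auto intro!: prod_nonneg prod_le_1 pmf_le_1)
  have sq: "(f y - p)\<^sup>2 = (1 - 2 * p) * f y + p\<^sup>2" for y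
    by (auto simp: f01 power2_eq_square algebra_simps)
  have var: "measure_pmf.expectation ?W (\<lambda>y. (f y - p)\<^sup>2) = p * (1 - p)"
    unfolding sq using int mean by (simp add: power2_eq_square algebra_simps)
  have bound: "\<bar>f y - p\<bar> \<le> 1" for y
    using p01 by (auto simp: f01)
  have tr: "map_pmf (\<lambda>x j i. x i j) ?Q = Pi_pmf {1..N} (\<lambda>_. 0) (\<lambda>_. ?W)"
    by (rule Pi_pmf_transpose) auto
  have "{y. \<bar>(\<Sum>j=1..N. \<Prod>i=1..K. of_bool (y i j = s i)) - real N * p\<bar> \<ge> 2 * l * real N * (p * (1 - p))}
      = (\<lambda>x j i. x i j) -` {x. \<bar>(\<Sum>j\<in>{1..N}. f (x j)) - real (card {1..N}) * p\<bar> \<ge> 2 * l * real (card {1..N}) * (p * (1 - p))}"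
    by (simp add: f_def vimage_def)
  then have "measure_pmf.prob ?Q {y. \<bar>(\<Sum>j=1..N. \<Prod>i=1..K. of_bool (y i j = s i)) - real N * p\<bar> \<ge> 2 * l * real N * (p * (1 - p))}
      = measure_pmf.prob (map_pmf (\<lambda>x j i. x i j) ?Q) {x. \<bar>(\<Sum>j\<in>{1..N}. f (x j)) - real (card {1..N}) * p\<bar> \<ge> 2 * l * real (card {1..N}) * (p * (1 - p))}"
    by (simp only: measure_map_pmf)
  also have "\<dots> \<le> 2 * exp (- (l\<^sup>2 * real (card {1..N}) * (p * (1 - p))))"
    unfolding tr by (rule Bernstein_Pi_pmf[OF finite_atLeastAtMost bound mean var l])
  finally show ?thesis by simp
qed

lemma num_boxes_tail:
  assumes M: "prob_space M"
    and meas: "\<And>i j. i \<in> {1..K} \<Longrightarrow> j \<in> {1..N} \<Longrightarrow> \<eta> i j \<in> measurable M (count_space UNIV)"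
    and b: "\<And>i k. i \<in> {1..K} \<Longrightarrow> b i k \<ge> 0" "\<And>i. i \<in> {1..K} \<Longrightarrow> b i 0 > 0"
    and \<theta>: "\<And>i. i \<in> {1..K} \<Longrightarrow> \<theta> i \<in> params (b i)"
    and scheme: "allocation_scheme M K b N n \<eta>"
    and pos: "\<And>i. i \<in> {1..K} \<Longrightarrow>
      measure_pmf.prob (xi_sample (b i) (\<theta> i) N) {x. (\<Sum>j=1..N. x j) = n i} > 0"
    and p: "p = box_prob K b \<theta> s" and l: "0 \<le> l" "l \<le> 1"
  shows "measure M {\<omega> \<in> space M. \<bar>num_boxes K N s \<eta> \<omega> - real N * p\<bar> \<ge> 2 * l * real N * (p * (1 - p))}
    \<le> 2 * exp (- (l\<^sup>2 * real N * (p * (1 - p))))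
       / (\<Prod>i=1..K. measure_pmf.prob (xi_sample (b i) (\<theta> i) N) {x. (\<Sum>j=1..N. x j) = n i})"
proof -
  let ?Z = "\<Prod>i=1..K. measure_pmf.prob (xi_sample (b i) (\<theta> i) N) {x. (\<Sum>j=1..N. x j) = n i}"
  let ?y = "\<lambda>\<omega> i j. if i \<in> {1..K} \<and> j \<in> {1..N} then \<eta> i j \<omega> else 0"
  define Bad where "Bad = {y :: nat \<Rightarrow> nat \<Rightarrow> nat.
     \<bar>(\<Sum>j=1..N. \<Prod>i=1..K. of_bool (y i j = s i)) - real N * p\<bar> \<ge> 2 * l * real N * (p * (1 - p))}"
  have pp: "p = (\<Prod>i=1..K. pmf (xi_pmf (b i) (\<theta> i)) (s i))"
    unfolding p box_prob_def using b \<theta> by (intro prod.cong refl pmf_xi_pmf[symmetric]) auto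
  have "num_boxes K N s \<eta> \<omega> = (\<Sum>j=1..N. \<Prod>i=1..K. of_bool (?y \<omega> i j = s i))" for \<omega>
    unfolding num_boxes_def by (intro sum.cong prod.cong refl) auto
  then have bad: "{\<omega> \<in> space M. \<bar>num_boxes K N s \<eta> \<omega> - real N * p\<bar> \<ge> 2 * l * real N * (p * (1 - p))}
      = {\<omega> \<in> space M. ?y \<omega> \<in> Bad}"
    by (simp only: Bad_def mem_Collect_eq)
  have "measure_pmf.prob (Pi_pmf {1..K} (\<lambda>_. 0) (\<lambda>i. xi_sample (b i) (\<theta> i) N)) Bad
      \<le> 2 * exp (- (l\<^sup>2 * real N * (p * (1 - p))))"
    unfolding xi_sample_def Bad_def by (rule box_count_independent_tail[OF pp l])
  then have "measure_pmf.prob (Pi_pmf {1..K} (\<lambda>_. 0) (\<lambda>i. xi_sample (b i) (\<theta> i) N)) Bad / ?Z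
      \<le> 2 * exp (- (l\<^sup>2 * real N * (p * (1 - p)))) / ?Z"
    by (rule divide_right_mono) (rule prod_nonneg, rule measure_nonneg)
  moreover have "measure M {\<omega> \<in> space M. ?y \<omega> \<in> Bad}
      \<le> measure_pmf.prob (Pi_pmf {1..K} (\<lambda>_. 0) (\<lambda>i. xi_sample (b i) (\<theta> i) N)) Bad / ?Z"
    by (rule allocation_scheme_prob_le[OF M meas b \<theta> scheme pos])
  ultimately show ?thesis
    unfolding bad by (rule order_trans[rotated])
qed

section \<open>Dependence of the box law on its parameter\<close>

lemma expectation_nat_pmf:
  fixes h :: "nat \<Rightarrow> real"
  assumes "summable (\<lambda>k. norm (h k * pmf p k))"
  shows "integrable (measure_pmf p) h" "measure_pmf.expectation p h = (\<Sum>k. h k * pmf p k)"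
proof -
  have "integrable (count_space UNIV) (\<lambda>k. pmf p k *\<^sub>R h k)"
    using assms by (simp add: integrable_count_space_nat_iff mult.commute)
  then show "integrable (measure_pmf p) h" "measure_pmf.expectation p h = (\<Sum>k. h k * pmf p k)"
    by (simp_all add: measure_pmf_eq_density integrable_density integral_density integral_count_space_nat mult.commute)
qed

lemma params_pos: "\<theta> \<in> params b \<Longrightarrow> 0 < \<theta>"
  by (simp add: params_def)

lemma params_downward: "\<theta> \<in> params b \<Longrightarrow> 0 < x \<Longrightarrow> x \<le> \<theta> \<Longrightarrow> x \<in> params b"
  by (auto simp: params_def intro: le_less_trans[of "ereal x" "ereal \<theta>"])

lemma params_open:
  assumes "\<theta> \<in> params b"
  obtains r where "r \<in> params b" "\<theta> < r"
proof -
  obtain r where "ereal \<theta> < ereal r" "ereal r < gen_radius b"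
    using assms ereal_dense2[of "ereal \<theta>" "gen_radius b"] by (auto simp: params_def)
  then show ?thesis using assms that[of r] by (auto simp: params_def)
qed

lemma summable_gen_fun:
  assumes "\<theta> \<in> params b"
  shows "summable (\<lambda>k. b k * \<theta> ^ k / fact k)"
proof -
  have "ereal (norm \<theta>) < conv_radius (\<lambda>k. b k / fact k)"
    using assms by (auto simp: params_def gen_radius_def)
  from summable_in_conv_radius[OF this] show ?thesis by (simp add: field_simps)
qed

context
  fixes b :: "nat \<Rightarrow> real"
  assumes nonneg: "\<And>k. b k \<ge> 0" and pos0: "b 0 > 0"
begin

text \<open>
  Compare with a larger parameter \<open>r\<close>: the factor \<open>(r / \<theta>)\<^sup>k\<close> grows exponentially and
  dominates \<open>k\<^sup>2\<close>.
\<close>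
lemma summable_square_gen_fun:
  assumes "\<theta> \<in> params b"
  shows "summable (\<lambda>k. (real k)\<^sup>2 * (b k * \<theta> ^ k / fact k))"
proof -
  obtain r where r: "r \<in> params b" "\<theta> < r" using params_open[OF assms] .
  have \<theta>: "0 < \<theta>" using params_pos[OF assms] .
  define c where "c = ln (r / \<theta>)"
  have c: "c > 0" using r \<theta> by (simp add: c_def)
  have le: "(real k)\<^sup>2 * \<theta> ^ k \<le> 2 / c\<^sup>2 * r ^ k" for k
  proof -
    have "(c * real k)\<^sup>2 / 2 \<le> exp (c * real k)"
      using exp_lower_Taylor_quadratic[of "c * real k"] c by (smt (verit) mult_nonneg_nonneg of_nat_0_le_iff)
    also have "exp (c * real k) = (r / \<theta>) ^ k"
      using r \<theta> by (simp add: c_def exp_of_nat2_mult)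
    finally have "(real k)\<^sup>2 \<le> 2 / c\<^sup>2 * (r / \<theta>) ^ k"
      using c by (simp add: power_mult_distrib pos_le_divide_eq mult.commute)
    then have "(real k)\<^sup>2 * \<theta> ^ k \<le> 2 / c\<^sup>2 * (r / \<theta>) ^ k * \<theta> ^ k"
      using \<theta> by (intro mult_right_mono) auto
    then show ?thesis using \<theta> by (simp add: power_divide)
  qed
  show ?thesis
  proof (rule summable_comparison_test'[of "\<lambda>k. 2 / c\<^sup>2 * (b k * r ^ k / fact k)" 0])
    show "summable (\<lambda>k. 2 / c\<^sup>2 * (b k * r ^ k / fact k))"
      by (intro summable_mult summable_gen_fun r)
    fix k
    have "(real k)\<^sup>2 * \<theta> ^ k * (b k / fact k) \<le> 2 / c\<^sup>2 * r ^ k * (b k / fact k)"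
      using nonneg[of k] by (intro mult_right_mono[OF le]) auto
    then show "norm ((real k)\<^sup>2 * (b k * \<theta> ^ k / fact k)) \<le> 2 / c\<^sup>2 * (b k * r ^ k / fact k)"
      using nonneg[of k] \<theta> by (simp add: mult_ac)
  qed
qed

lemma summable_deriv_gen_fun:
  assumes "\<theta> \<in> params b"
  shows "summable (\<lambda>k. real k * (b k * \<theta> ^ k / fact k))"
proof (rule summable_comparison_test'[OF summable_square_gen_fun[OF assms], of 0])
  fix k
  have "real k \<le> (real k)\<^sup>2" by (cases k) (auto simp: power2_eq_square)
  then show "norm (real k * (b k * \<theta> ^ k / fact k)) \<le> (real k)\<^sup>2 * (b k * \<theta> ^ k / fact k)"
    using nonneg[of k] params_pos[OF assms]
    by (simp add: abs_mult mult_right_mono divide_right_mono)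
qed

lemma gen_fun_ge: "\<theta> \<in> params b \<Longrightarrow> gen_fun b \<theta> \<ge> b 0"
  unfolding gen_fun_def
  using sum_le_suminf[OF summable_gen_fun[of \<theta> b], of "{0}"] nonneg params_pos[of \<theta> b] by auto

lemma gen_fun_pos: "\<theta> \<in> params b \<Longrightarrow> gen_fun b \<theta> > 0"
  using gen_fun_ge pos0 by fastforce

lemma gen_fun_mono: "x \<in> params b \<Longrightarrow> y \<in> params b \<Longrightarrow> x \<le> y \<Longrightarrow> gen_fun b x \<le> gen_fun b y"
  unfolding gen_fun_def
  using nonneg params_pos[of x b]
  by (intro suminf_le summable_gen_fun divide_right_mono mult_left_mono power_mono) auto

lemma xi_pmf_moments:
  assumes "\<theta> \<in> params b"
  shows "xi_mean b \<theta> = (\<Sum>k. real k * (b k * \<theta> ^ k / fact k)) / gen_fun b \<theta>"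
    and "integrable (measure_pmf (xi_pmf b \<theta>)) (\<lambda>k. (real k)\<^sup>2)"
    and "measure_pmf.expectation (xi_pmf b \<theta>) (\<lambda>k. (real k)\<^sup>2)
      = (\<Sum>k. (real k)\<^sup>2 * (b k * \<theta> ^ k / fact k)) / gen_fun b \<theta>"
proof -
  have eq: "h k * pmf (xi_pmf b \<theta>) k = h k * (b k * \<theta> ^ k / fact k) / gen_fun b \<theta>" for h :: "nat \<Rightarrow> real" and k
    unfolding pmf_xi_pmf[of b, OF nonneg pos0 assms] by simp
  have eqn: "norm (h k * pmf (xi_pmf b \<theta>) k) = h k * (b k * \<theta> ^ k / fact k) / gen_fun b \<theta>"
    if "h k \<ge> 0" for h :: "nat \<Rightarrow> real" and k
    unfolding eq using that nonneg[of k] params_pos[OF assms] gen_fun_pos[OF assms] by simp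
  have 1: "summable (\<lambda>k. norm (real k * pmf (xi_pmf b \<theta>) k))"
    unfolding eqn[of real, OF of_nat_0_le_iff] by (rule summable_divide[OF summable_deriv_gen_fun[OF assms]])
  have 2: "summable (\<lambda>k. norm ((real k)\<^sup>2 * pmf (xi_pmf b \<theta>) k))"
    unfolding eqn[of "\<lambda>k. (real k)\<^sup>2", OF zero_le_power2] by (rule summable_divide[OF summable_square_gen_fun[OF assms]])
  show "xi_mean b \<theta> = (\<Sum>k. real k * (b k * \<theta> ^ k / fact k)) / gen_fun b \<theta>"
    unfolding xi_mean_def expectation_nat_pmf(2)[OF 1] eq
    by (rule suminf_divide[OF summable_deriv_gen_fun[OF assms]])
  show "integrable (measure_pmf (xi_pmf b \<theta>)) (\<lambda>k. (real k)\<^sup>2)"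
    by (rule expectation_nat_pmf(1)[OF 2])
  show "measure_pmf.expectation (xi_pmf b \<theta>) (\<lambda>k. (real k)\<^sup>2)
      = (\<Sum>k. (real k)\<^sup>2 * (b k * \<theta> ^ k / fact k)) / gen_fun b \<theta>"
    unfolding expectation_nat_pmf(2)[OF 2] eq[of "\<lambda>k. (real k)\<^sup>2"]
    by (rule suminf_divide[OF summable_square_gen_fun[OF assms]])
qed

text \<open>
  The law with parameter \<open>y\<close> is the law with parameter \<open>x\<close> tilted by the increasing weight
  \<open>\<rho>\<^sup>k\<close>. With \<open>m\<close> the mean at \<open>x\<close>, each term satisfies \<open>(k - m) (\<rho>\<^sup>k - \<rho>\<^sup>m) \<ge> 0\<close>, so tilting cannot
  lower the mean.
\<close>
lemma xi_mean_mono: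
  assumes x: "x \<in> params b" and y: "y \<in> params b" and "x < y"
  shows "xi_mean b x \<le> xi_mean b y"
proof -
  define m where "m = xi_mean b x"
  define a where "a k = b k * x ^ k / fact k" for k
  have x0: "0 < x" and y0: "0 < y" using x y params_pos by auto
  define \<rho> where "\<rho> = y / x"
  have \<rho>: "\<rho> > 1" using \<open>x < y\<close> x0 by (simp add: \<rho>_def)
  have ay: "b k * y ^ k / fact k = \<rho> powr real k * a k" for k
    using x0 \<rho> by (simp add: \<rho>_def a_def powr_realpow power_divide)
  have a0: "a k \<ge> 0" for k using nonneg[of k] x0 by (simp add: a_def)
  have sx: "(\<lambda>k. (real k - m) * a k) sums 0"
  proof -
    have "(\<lambda>k. real k * a k - m * a k) sums ((\<Sum>k. real k * a k) - m * gen_fun b x)"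
      unfolding a_def gen_fun_def
      by (intro sums_diff sums_mult summable_sums summable_gen_fun summable_deriv_gen_fun x)
    moreover have "(\<Sum>k. real k * a k) = m * gen_fun b x"
      unfolding m_def xi_pmf_moments(1)[OF x] a_def using gen_fun_pos[OF x] by simp
    ultimately show ?thesis by (simp add: left_diff_distrib)
  qed
  have sy: "(\<lambda>k. (real k - m) * (\<rho> powr real k * a k))
      sums ((\<Sum>k. real k * (b k * y ^ k / fact k)) - m * gen_fun b y)"
    unfolding left_diff_distrib ay[symmetric] gen_fun_def
    by (intro sums_diff sums_mult summable_sums summable_gen_fun summable_deriv_gen_fun y)
  have "\<rho> powr m * 0 \<le> (\<Sum>k. real k * (b k * y ^ k / fact k)) - m * gen_fun b y"
  proof (rule sums_le[OF _ sums_mult[OF sx] sy])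
    fix k
    have "\<rho> powr m * (real k - m) \<le> \<rho> powr real k * (real k - m)"
    proof (cases "real k \<ge> m")
      case True
      then show ?thesis using \<rho> by (intro mult_right_mono powr_mono) auto
    next
      case False
      then show ?thesis using \<rho> by (intro mult_right_mono_neg powr_mono) auto
    qed
    then have "\<rho> powr m * (real k - m) * a k \<le> \<rho> powr real k * (real k - m) * a k"
      by (rule mult_right_mono[OF _ a0])
    then show "\<rho> powr m * ((real k - m) * a k) \<le> (real k - m) * (\<rho> powr real k * a k)"
      by (simp add: mult_ac)
  qed
  then show ?thesis
    unfolding m_def[symmetric] xi_pmf_moments(1)[OF y] using gen_fun_pos[OF y]
    by (simp add: pos_le_divide_eq)
qed

lemma continuous_on_xi_mean:
  assumes x: "x \<in> params b" and y: "y \<in> params b"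
  shows "continuous_on {x..y} (xi_mean b)"
proof -
  obtain r where r: "r \<in> params b" "y < r" using params_open[OF y] .
  have x0: "0 < x" using x params_pos by auto
  have sub: "t \<in> params b" if "t \<in> {x..y}" for t
    using that params_downward[OF y, of t] x0 by auto
  have "isCont (\<lambda>t. \<Sum>k. b k / fact k * t ^ k) t" if "t \<in> {x..y}" for t
  proof (rule isCont_powser[of _ r])
    show "summable (\<lambda>k. b k / fact k * r ^ k)" using summable_gen_fun[OF r(1)] by simp
  qed (use that x0 r in auto)
  moreover have "isCont (\<lambda>t. \<Sum>k. real k * b k / fact k * t ^ k) t" if "t \<in> {x..y}" for t
  proof (rule isCont_powser[of _ r])
    show "summable (\<lambda>k. real k * b k / fact k * r ^ k)"
      using summable_deriv_gen_fun[OF r(1)] by (simp add: mult.assoc)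
  qed (use that x0 r in auto)
  moreover have "(\<Sum>k. b k / fact k * t ^ k) \<noteq> 0" if "t \<in> {x..y}" for t
    using gen_fun_pos[OF sub[OF that]] by (simp add: gen_fun_def)
  ultimately have "continuous_on {x..y} (\<lambda>t. (\<Sum>k. real k * b k / fact k * t ^ k) / (\<Sum>k. b k / fact k * t ^ k))"
    by (intro continuous_on_divide continuous_at_imp_continuous_on) auto
  then show ?thesis
    by (rule continuous_on_cong[THEN iffD1, rotated -1])
       (auto simp: xi_pmf_moments(1)[OF sub] gen_fun_def mult.assoc)
qed

text \<open>
  The series of \<open>\<theta> B'(\<theta>)\<close> has no constant term, so scaling \<open>\<theta>\<close> by \<open>u \<le> 1\<close> shrinks
  it at least by the factor \<open>u\<close>, while the denominator stays above \<open>b 0\<close>.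
\<close>
lemma xi_mean_small:
  assumes y: "y \<in> params b" and \<alpha>: "\<alpha> > 0"
  obtains x where "x \<in> params b" "x \<le> y" "xi_mean b x < \<alpha>"
proof -
  define A where "A = (\<Sum>k. real k * (b k * y ^ k / fact k))"
  have y0: "0 < y" using y params_pos by auto
  have A0: "A \<ge> 0"
    unfolding A_def using nonneg y0 by (intro suminf_nonneg summable_deriv_gen_fun y) auto
  define u where "u = min 1 (\<alpha> * b 0 / (A + 1))"
  have u: "0 < u" "u \<le> 1" using \<alpha> pos0 A0 by (auto simp: u_def)
  have uy: "u * y \<in> params b" using params_downward[OF y, of "u * y"] u y0 by simp
  have "(\<Sum>k. real k * (b k * (u * y) ^ k / fact k)) \<le> (\<Sum>k. u * (real k * (b k * y ^ k / fact k)))"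
  proof (intro suminf_le summable_mult summable_deriv_gen_fun uy y)
    fix k
    have "real k * u ^ k \<le> real k * u"
      using u by (cases k) (auto intro!: mult_left_mono simp: mult_left_le power_le_one)
    then have "real k * u ^ k * (b k * y ^ k / fact k) \<le> real k * u * (b k * y ^ k / fact k)"
      using nonneg y0 by (intro mult_right_mono) auto
    then show "real k * (b k * (u * y) ^ k / fact k) \<le> u * (real k * (b k * y ^ k / fact k))"
      by (simp add: power_mult_distrib mult_ac)
  qed
  also have "\<dots> = u * A"
    unfolding A_def by (rule suminf_mult[OF summable_deriv_gen_fun[OF y]])
  also have "\<dots> \<le> \<alpha> * b 0 / (A + 1) * A"
    using A0 by (intro mult_right_mono) (auto simp: u_def)
  also have "\<dots> < \<alpha> * b 0"
    using A0 \<alpha> pos0 by (simp add: field_simps)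
  also have "\<dots> \<le> \<alpha> * gen_fun b (u * y)"
    using \<alpha> gen_fun_ge[OF uy] by simp
  finally have "xi_mean b (u * y) < \<alpha>"
    unfolding xi_pmf_moments(1)[OF uy] using gen_fun_pos[OF uy] by (simp add: pos_divide_less_eq)
  moreover have "u * y \<le> y" using u y0 by (simp add: mult_left_le_one_le)
  ultimately show ?thesis using that uy by blast
qed

text \<open>
  Existence of the inverse value follows from the intermediate value theorem. Monotonicity confines it
  between a parameter with mean below \<open>\<alpha>'\<close> and one with mean \<open>\<alpha>''\<close>.
\<close>
lemma xi_mean_inv_compact:
  assumes \<alpha>: "0 < \<alpha>'" "\<alpha>' < \<alpha>''" and top: "\<exists>\<theta>\<in>params b. \<alpha>'' = xi_mean b \<theta>"
  obtains lo hi where "lo \<in> params b" "hi \<in> params b"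
    "\<And>\<alpha>. \<alpha>' < \<alpha> \<Longrightarrow> \<alpha> < \<alpha>'' \<Longrightarrow>
       lo \<le> xi_mean_inv b \<alpha> \<and> xi_mean_inv b \<alpha> \<le> hi \<and> xi_mean b (xi_mean_inv b \<alpha>) = \<alpha>"
proof -
  obtain hi where hi: "hi \<in> params b" "\<alpha>'' = xi_mean b hi" using top by blast
  obtain lo where lo: "lo \<in> params b" "lo \<le> hi" "xi_mean b lo < \<alpha>'" using xi_mean_small[OF hi(1) \<alpha>(1)] .
  show ?thesis
  proof (rule that[OF lo(1) hi(1)])
    fix \<alpha> assume a: "\<alpha>' < \<alpha>" "\<alpha> < \<alpha>''"
    obtain \<theta> where "lo \<le> \<theta>" "\<theta> \<le> hi" "xi_mean b \<theta> = \<alpha>"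
      using IVT'[of "xi_mean b" lo \<alpha> hi] lo a hi continuous_on_xi_mean[OF lo(1) hi(1)] by auto
    then have "\<alpha> \<in> xi_mean b ` params b"
      using params_downward[OF hi(1), of \<theta>] params_pos[OF lo(1)] by auto
    then have inv: "xi_mean_inv b \<alpha> \<in> params b" "xi_mean b (xi_mean_inv b \<alpha>) = \<alpha>"
      unfolding xi_mean_inv_def by (auto intro: inv_into_into f_inv_into_f)
    have "lo \<le> xi_mean_inv b \<alpha>"
    proof (rule ccontr)
      assume "\<not> lo \<le> xi_mean_inv b \<alpha>"
      then have "\<alpha> \<le> xi_mean b lo" using xi_mean_mono[OF inv(1) lo(1)] inv(2) by simp
      then show False using lo(3) a(1) by simp
    qed
    moreover have "xi_mean_inv b \<alpha> \<le> hi"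
    proof (rule ccontr)
      assume "\<not> xi_mean_inv b \<alpha> \<le> hi"
      then have "xi_mean b hi \<le> \<alpha>" using xi_mean_mono[OF hi(1) inv(1)] inv(2) by simp
      then show False using hi(2) a(2) by simp
    qed
    ultimately show "lo \<le> xi_mean_inv b \<alpha> \<and> xi_mean_inv b \<alpha> \<le> hi \<and> xi_mean b (xi_mean_inv b \<alpha>) = \<alpha>"
      using inv by blast
  qed
qed

text \<open>
  The upper bound \<open>1 - q\<close> holds because \<open>0\<close> or \<open>1\<close> is a value different from \<open>s\<close> that has probability
  at least \<open>q\<close>.
\<close>
lemma xi_pmf_uniform_bounds:
  assumes lo: "lo \<in> params b" and hi: "hi \<in> params b" and pos1: "b 1 > 0" and s: "b s > 0"
  obtains q V where "q > 0" "V \<ge> 0"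
    "\<And>\<theta>. lo \<le> \<theta> \<Longrightarrow> \<theta> \<le> hi \<Longrightarrow> q \<le> pmf (xi_pmf b \<theta>) 0 \<and> q \<le> pmf (xi_pmf b \<theta>) 1
       \<and> q \<le> pmf (xi_pmf b \<theta>) s \<and> pmf (xi_pmf b \<theta>) s \<le> 1 - q
       \<and> measure_pmf.expectation (xi_pmf b \<theta>) (\<lambda>k. (real k)\<^sup>2) \<le> V"
proof -
  define c where "c k = b k * lo ^ k / (fact k * gen_fun b hi)" for k
  define q where "q = Min {c 0, c 1, c s}"
  define V where "V = (\<Sum>k. (real k)\<^sup>2 * (b k * hi ^ k / fact k)) / b 0"
  have lo0: "0 < lo" and hi0: "0 < hi" using lo hi params_pos by auto
  show ?thesis
  proof (rule that[of q V])
    show "q > 0"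
      using pos0 pos1 s lo0 gen_fun_pos[OF hi] by (auto simp: q_def c_def)
    show "V \<ge> 0"
      unfolding V_def using nonneg pos0 hi0
      by (intro divide_nonneg_pos suminf_nonneg summable_square_gen_fun hi) auto
    fix \<theta> assume \<theta>: "lo \<le> \<theta>" "\<theta> \<le> hi"
    have p\<theta>: "\<theta> \<in> params b" using params_downward[OF hi, of \<theta>] \<theta> lo0 by simp
    let ?D = "xi_pmf b \<theta>"
    have ge: "c k \<le> pmf ?D k" for k
      unfolding pmf_xi_pmf[of b, OF nonneg pos0 p\<theta>] c_def
      using nonneg[of k] lo0 \<theta> gen_fun_pos[OF p\<theta>] gen_fun_mono[OF p\<theta> hi]
      by (intro frac_le mult_mono power_mono) auto
    have q_le: "q \<le> c 0" "q \<le> c 1" "q \<le> c s" by (auto simp: q_def)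
    have 0: "q \<le> pmf ?D 0" "q \<le> pmf ?D 1" "q \<le> pmf ?D s"
      using q_le ge[of 0] ge[of 1] ge[of s] by linarith+
    define k where "k = (if s = 0 then 1 else 0 :: nat)"
    have "pmf ?D s + pmf ?D k = measure_pmf.prob ?D {s, k}"
      by (simp add: measure_measure_pmf_finite k_def)
    also have "\<dots> \<le> 1" by (rule measure_pmf.prob_le_1)
    finally have "pmf ?D s \<le> 1 - pmf ?D k" by linarith
    moreover have "q \<le> pmf ?D k" using 0 by (simp add: k_def)
    ultimately have 1: "pmf ?D s \<le> 1 - q" by linarith
    have "measure_pmf.expectation ?D (\<lambda>k. (real k)\<^sup>2)
        = (\<Sum>k. (real k)\<^sup>2 * (b k * \<theta> ^ k / fact k)) / gen_fun b \<theta>"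
      by (rule xi_pmf_moments(3)[OF p\<theta>])
    also have "\<dots> \<le> V"
      unfolding V_def
    proof (rule frac_le)
      show "(\<Sum>k. (real k)\<^sup>2 * (b k * \<theta> ^ k / fact k)) \<le> (\<Sum>k. (real k)\<^sup>2 * (b k * hi ^ k / fact k))"
        using nonneg \<theta> lo0
        by (intro suminf_le summable_square_gen_fun p\<theta> hi mult_left_mono divide_right_mono power_mono) auto
      show "0 \<le> (\<Sum>k. (real k)\<^sup>2 * (b k * hi ^ k / fact k))"
        using nonneg hi0 by (intro suminf_nonneg summable_square_gen_fun hi) auto
    qed (use pos0 gen_fun_ge[OF p\<theta>] in auto)
    finally have "measure_pmf.expectation ?D (\<lambda>k. (real k)\<^sup>2) \<le> V" .
    then show "q \<le> pmf ?D 0 \<and> q \<le> pmf ?D 1 \<and> q \<le> pmf ?D s \<and> pmf ?D s \<le> 1 - q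
       \<and> measure_pmf.expectation ?D (\<lambda>k. (real k)\<^sup>2) \<le> V"
      using 0 1 by blast
  qed
qed

end

section \<open>From tail bounds to an almost sure upper limit\<close>

text \<open>
  Let \<open>r\<close> be the normalisation. The tail bound with \<open>c\<^sub>1 > 2 \<surd>(1 + \<kappa>)\<close> is summable, so almost surely
  \<open>|X - x| < c\<^sub>1 r\<close> eventually. For the expectation it suffices that \<open>N\<close> times the tail bound
  is \<open>o(\<surd>N)\<close>, which holds already for \<open>c\<^sub>2 = \<surd>(3 + 4 \<kappa>) < 2 \<surd>(1 + \<kappa>)\<close>, where it equals
  \<open>C N\<^bsup>1/4\<^esup>\<close>. This leaves room for \<open>c\<^sub>1\<close> above its threshold and for the error \<open>\<delta> r\<close>.
\<close>
lemma limsup_deviation_from_mean_le: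
  fixes X :: "nat \<Rightarrow> 'w \<Rightarrow> real" and N :: "nat \<Rightarrow> nat" and x \<sigma> :: "nat \<Rightarrow> real"
  assumes M: "prob_space M" and X[measurable]: "\<And>t. X t \<in> borel_measurable M"
    and dev: "\<And>t \<omega>. \<bar>X t \<omega> - x t\<bar> \<le> real (N t)"
    and N: "strict_mono N" and v: "v > 0" and \<sigma>: "\<And>t. \<sigma> t \<ge> v" and \<kappa>: "\<kappa> \<ge> 0"
    and C: "C \<ge> 0"
    and tail: "\<And>c. c \<ge> 0 \<Longrightarrow> eventually (\<lambda>t.
      measure M {\<omega> \<in> space M. \<bar>X t \<omega> - x t\<bar> \<ge> c * (sqrt (real (N t) * ln (real (N t))) * \<sigma> t)}
        \<le> C * real (N t) powr (\<kappa> - c\<^sup>2 / 4)) sequentially"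
  shows "AE \<omega> in M. limsup (\<lambda>t. ereal (\<bar>X t \<omega> - prob_space.expectation M (X t)\<bar> /
       (sqrt (real (N t) * ln (real (N t))) * \<sigma> t))) \<le> ereal (4 * sqrt (1 + \<kappa>))"
proof -
  interpret prob_space M by (rule M)
  define r where "r t = sqrt (real (N t) * ln (real (N t))) * \<sigma> t" for t
  define B where "B c t = {\<omega> \<in> space M. \<bar>X t \<omega> - x t\<bar> \<ge> c * r t}" for c t
  have B_sets [measurable]: "B c t \<in> events" for c t unfolding B_def by measurable
  have N_lim: "filterlim N at_top sequentially" by (rule filterlim_subseq[OF N])
  have N_gt: "t \<le> N t" for t using seq_suble[OF N] .
  define c2 where "c2 = sqrt (3 + 4 * \<kappa>)"
  \<comment> \<open>\<open>\<delta>\<close> is half of the gap between \<open>2 \<surd>(1 + \<kappa>)\<close> and \<open>c2\<close>, so that \<open>c1 + c2 + \<delta> = 4 \<surd>(1 + \<kappa>)\<close>.\<close>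
  define \<delta> where "\<delta> = sqrt (1 + \<kappa>) - c2 / 2"
  define c1 where "c1 = 2 * sqrt (1 + \<kappa>) + \<delta>"
  have c2: "c2 \<ge> 0" "c2\<^sup>2 / 4 = 3 / 4 + \<kappa>" using \<kappa> by (auto simp: c2_def)
  have "c2 < sqrt (4 * (1 + \<kappa>))" unfolding c2_def by simp
  then have \<delta>: "\<delta> > 0" unfolding \<delta>_def real_sqrt_mult by simp
  have c1: "c1 > 0" using \<delta> \<kappa> by (simp add: c1_def add_nonneg_pos)
  define e where "e = c1\<^sup>2 / 4 - \<kappa>"
  have "(2 * sqrt (1 + \<kappa>))\<^sup>2 < c1\<^sup>2"
    unfolding c1_def using \<delta> \<kappa> by (intro power_strict_mono) auto
  then have e: "e > 1" using \<kappa> by (simp add: e_def power_mult_distrib)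
  have sum_c: "c1 + c2 + \<delta> = 4 * sqrt (1 + \<kappa>)" by (simp add: c1_def \<delta>_def)

  have N2: "eventually (\<lambda>t. N t \<ge> 2) sequentially"
    using N_lim by (simp add: filterlim_at_top)
  have r_pos: "r t > 0" if "N t \<ge> 2" for t
    unfolding r_def using that \<sigma>[of t] v by (intro mult_pos_pos) auto
  have r_ge: "sqrt (real (N t) * ln (real (N t))) * v \<le> r t" if "N t \<ge> 2" for t
    unfolding r_def using that \<sigma>[of t] by (intro mult_left_mono) auto

  have bound_expectation: "eventually (\<lambda>t. \<bar>expectation (X t) - x t\<bar> \<le> (c2 + \<delta>) * r t) sequentially"
  proof -
    have "((\<lambda>n. real n powr (1/4) / sqrt (real n * ln (real n))) \<longlongrightarrow> 0) at_top"
      by real_asymp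
    moreover have "\<delta> * v / (C + 1) > 0" using \<delta> v C by simp
    ultimately have "eventually (\<lambda>n. real n powr (1/4) / sqrt (real n * ln (real n)) < \<delta> * v / (C + 1)) at_top"
      by (rule order_tendstoD(2))
    then have small: "eventually (\<lambda>t. real (N t) powr (1/4) / sqrt (real (N t) * ln (real (N t))) < \<delta> * v / (C + 1)) sequentially"
      using filterlim_iff[THEN iffD1, OF N_lim] by blast
    show ?thesis
      using small N2 tail[OF c2(1)]
    proof eventually_elim
      case (elim t)
      have N0: "real (N t) > 0" using elim(2) by simp
      have rp: "r t > 0" using r_pos elim(2) .
      have intX: "integrable M (X t)"
      proof (rule integrable_const_bound[where B = "real (N t) + \<bar>x t\<bar>"])
        have "\<bar>X t \<omega>\<bar> \<le> real (N t) + \<bar>x t\<bar>" for \<omega> using dev[of t \<omega>] by linarith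
        then show "AE \<omega> in M. norm (X t \<omega>) \<le> real (N t) + \<bar>x t\<bar>" by simp
      qed simp
      have "\<bar>expectation (X t) - x t\<bar> = \<bar>expectation (\<lambda>\<omega>. X t \<omega> - x t)\<bar>"
        using intX by (simp add: prob_space)
      also have "\<dots> \<le> expectation (\<lambda>\<omega>. \<bar>X t \<omega> - x t\<bar>)" by (rule integral_abs_bound)
      also have "\<dots> \<le> expectation (\<lambda>\<omega>. c2 * r t + real (N t) * indicator (B c2 t) \<omega>)"
      proof (rule integral_mono)
        show "integrable M (\<lambda>\<omega>. c2 * r t + real (N t) * indicator (B c2 t) \<omega>)"
          by (intro Bochner_Integration.integrable_add integrable_mult_right integrable_real_indicator)
             (auto simp: emeasure_eq_measure)
        have c2r: "0 \<le> c2 * r t" using c2(1) rp by simp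
        show "\<bar>X t \<omega> - x t\<bar> \<le> c2 * r t + real (N t) * indicator (B c2 t) \<omega>" if "\<omega> \<in> space M" for \<omega>
          using dev[of t \<omega>] c2r that by (auto simp: B_def indicator_def)
      qed (use intX in auto)
      also have "\<dots> = c2 * r t + real (N t) * prob (B c2 t)"
        by (simp add: prob_space emeasure_eq_measure)
      also have "\<dots> \<le> c2 * r t + real (N t) * (C * real (N t) powr (\<kappa> - c2\<^sup>2 / 4))"
        using elim(3) by (auto simp: B_def r_def intro!: mult_left_mono)
      also have "real (N t) * (C * real (N t) powr (\<kappa> - c2\<^sup>2 / 4)) = C * real (N t) powr (1/4)"
      proof -
        have "real (N t) powr 1 * real (N t) powr (\<kappa> - c2\<^sup>2 / 4) = real (N t) powr (1/4)"
          unfolding powr_add[symmetric] c2(2) by simp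
        then show ?thesis using N0 by (simp add: mult_ac)
      qed
      also have "C * real (N t) powr (1/4) \<le> \<delta> * r t"
      proof -
        have L: "sqrt (real (N t) * ln (real (N t))) > 0" using elim(2) by simp
        have "C * real (N t) powr (1/4) \<le> (C + 1) * real (N t) powr (1/4)"
          by (rule mult_right_mono) auto
        also have "\<dots> \<le> \<delta> * v * sqrt (real (N t) * ln (real (N t)))"
          using elim(1) L C by (simp add: field_simps)
        also have "\<dots> \<le> \<delta> * r t"
          using r_ge[OF elim(2)] \<delta> by (simp add: mult.assoc mult.commute)
        finally show ?thesis .
      qed
      finally show ?case by (simp add: distrib_right)
    qed
  qed

  have "summable (\<lambda>t. measure M (B c1 t))"
  proof (rule summable_comparison_test_ev)
    show "eventually (\<lambda>t. norm (measure M (B c1 t)) \<le> C * real t powr (- e)) sequentially"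
      using tail[OF less_imp_le[OF c1]] eventually_gt_at_top[of 0]
    proof eventually_elim
      case (elim t)
      have "measure M (B c1 t) \<le> C * real (N t) powr (- e)"
        using elim(1) by (simp add: B_def r_def e_def)
      also have "\<dots> \<le> C * real t powr (- e)"
        using N_gt[of t] elim(2) e C by (intro mult_left_mono powr_mono2') auto
      finally show ?case by simp
    qed
    show "summable (\<lambda>t. C * real t powr (- e))"
      using e by (intro summable_mult) (simp add: summable_real_powr_iff)
  qed
  then have "AE \<omega> in M. eventually (\<lambda>t. \<omega> \<in> space M - B c1 t) sequentially"
    by (intro borel_cantelli_AE1) (auto simp: emeasure_eq_measure)
  then show ?thesis
  proof eventually_elim
    case (elim \<omega>)
    have "eventually (\<lambda>t. ereal (\<bar>X t \<omega> - expectation (X t)\<bar> / r t) \<le> ereal (4 * sqrt (1 + \<kappa>))) sequentially"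
      using elim N2 bound_expectation
    proof eventually_elim
      case (elim t)
      have "\<bar>X t \<omega> - x t\<bar> \<le> c1 * r t" using elim(1) by (auto simp: B_def)
      then have "\<bar>X t \<omega> - expectation (X t)\<bar> \<le> c1 * r t + (c2 + \<delta>) * r t"
        using elim(3) by linarith
      also have "\<dots> = 4 * sqrt (1 + \<kappa>) * r t"
        unfolding sum_c[symmetric] by (simp add: distrib_right)
      finally show ?case using r_pos[OF elim(2)] by (simp add: pos_divide_le_eq)
    qed
    then show ?case unfolding r_def by (rule Limsup_bounded)
  qed
qed

section \<open>Fluctuations of the number of boxes with given contents\<close>

text \<open>
  All that the main argument needs about one colour, with constants independent of the
  ratio \<open>\<alpha>\<close> of balls to boxes.
\<close>
lemma colour_uniform_bounds:
  fixes b :: "nat \<Rightarrow> real"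
  assumes nonneg: "\<And>k. b k \<ge> 0" and pos0: "b 0 > 0" and pos1: "b 1 > 0" and s: "b s > 0"
    and \<alpha>: "0 < \<alpha>'" "\<alpha>' < \<alpha>''" and top: "\<exists>\<theta>\<in>params b. \<alpha>'' = xi_mean b \<theta>"
  shows "\<exists>c q N0. c > 0 \<and> q > 0 \<and> (\<forall>\<alpha>. \<alpha>' < \<alpha> \<longrightarrow> \<alpha> < \<alpha>'' \<longrightarrow>
      xi_mean_inv b \<alpha> \<in> params b
      \<and> q \<le> pmf (xi_pmf b (xi_mean_inv b \<alpha>)) s \<and> pmf (xi_pmf b (xi_mean_inv b \<alpha>)) s \<le> 1 - q
      \<and> (\<forall>N n. real n = real N * \<alpha> \<longrightarrow> N \<ge> N0 \<longrightarrow>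
          c / sqrt (real N) \<le> measure_pmf.prob (xi_sample b (xi_mean_inv b \<alpha>) N) {x. (\<Sum>j=1..N. x j) = n}))"
proof -
  obtain lo hi where lohi: "lo \<in> params b" "hi \<in> params b"
    and inv: "\<And>\<alpha>. \<alpha>' < \<alpha> \<Longrightarrow> \<alpha> < \<alpha>'' \<Longrightarrow>
       lo \<le> xi_mean_inv b \<alpha> \<and> xi_mean_inv b \<alpha> \<le> hi \<and> xi_mean b (xi_mean_inv b \<alpha>) = \<alpha>"
    using xi_mean_inv_compact[of b, OF nonneg pos0 \<alpha> top] by blast
  obtain q V where q: "q > 0" and V: "V \<ge> 0"
    and bounds: "\<And>\<theta>. lo \<le> \<theta> \<Longrightarrow> \<theta> \<le> hi \<Longrightarrow> q \<le> pmf (xi_pmf b \<theta>) 0 \<and> q \<le> pmf (xi_pmf b \<theta>) 1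
       \<and> q \<le> pmf (xi_pmf b \<theta>) s \<and> pmf (xi_pmf b \<theta>) s \<le> 1 - q
       \<and> measure_pmf.expectation (xi_pmf b \<theta>) (\<lambda>k. (real k)\<^sup>2) \<le> V"
    using xi_pmf_uniform_bounds[of b, OF nonneg pos0 lohi pos1 s] by blast
  obtain c N0 where c: "c > 0" and local:
    "\<And>(D :: nat pmf) N n. \<lbrakk>q \<le> pmf D 0; q \<le> pmf D 1; integrable (measure_pmf D) (\<lambda>k. (real k)\<^sup>2);
       measure_pmf.expectation D (\<lambda>k. (real k)\<^sup>2) \<le> V; N \<ge> N0;
       real n = real N * measure_pmf.expectation D real\<rbrakk>
     \<Longrightarrow> c / sqrt (real N) \<le> measure_pmf.prob (Pi_pmf {1..N} 0 (\<lambda>_. D)) {x. (\<Sum>j=1..N. x j) = n}"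
    using prob_sum_eq_mean_ge[OF q V] by blast
  show ?thesis
  proof (intro exI conjI allI impI)
    show "c > 0" "q > 0" by fact+
    fix \<alpha> assume \<alpha>: "\<alpha>' < \<alpha>" "\<alpha> < \<alpha>''"
    let ?\<theta> = "xi_mean_inv b \<alpha>"
    have \<theta>: "lo \<le> ?\<theta>" "?\<theta> \<le> hi" "xi_mean b ?\<theta> = \<alpha>" using inv[OF \<alpha>] by blast+
    show p\<theta>: "?\<theta> \<in> params b"
      using params_downward[OF lohi(2) _ \<theta>(2)] params_pos[OF lohi(1)] \<theta>(1)
      by simp
    note bd = bounds[OF \<theta>(1,2)]
    show "q \<le> pmf (xi_pmf b ?\<theta>) s" "pmf (xi_pmf b ?\<theta>) s \<le> 1 - q" using bd by blast+
    fix N n assume n: "real n = real N * \<alpha>" and N: "N \<ge> N0"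
    show "c / sqrt (real N) \<le> measure_pmf.prob (xi_sample b ?\<theta> N) {x. (\<Sum>j=1..N. x j) = n}"
      unfolding xi_sample_def
    proof (rule local)
      show "real n = real N * measure_pmf.expectation (xi_pmf b ?\<theta>) real"
        using n \<theta>(3) by (simp add: xi_mean_def)
    qed (use bd N xi_pmf_moments(2)[of b, OF nonneg pos0 p\<theta>] in blast)+
  qed
qed

theorem theorem2p1:
  fixes K :: nat
    and b :: "nat \<Rightarrow> nat \<Rightarrow> real"
    and \<alpha>' \<alpha>'' :: "nat \<Rightarrow> real"
    and N :: "nat \<Rightarrow> nat"
    and n :: "nat \<Rightarrow> nat \<Rightarrow> nat"
    and s :: "nat \<Rightarrow> nat"
    and M :: "'w measure"
    and \<eta> :: "nat \<Rightarrow> nat \<Rightarrow> nat \<Rightarrow> 'w \<Rightarrow> nat"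
    and \<mu> :: "nat \<Rightarrow> 'w \<Rightarrow> real"
    and \<theta> :: "nat \<Rightarrow> nat \<Rightarrow> real"
    and p \<sigma> :: "nat \<Rightarrow> real"
  assumes "K \<ge> 1"
    and "\<And>i k. i \<in> {1..K} \<Longrightarrow> b i k \<ge> 0"
    and "\<And>i. i \<in> {1..K} \<Longrightarrow> b i 0 > 0"
    and "\<And>i. i \<in> {1..K} \<Longrightarrow> b i 1 > 0"
    and "\<And>i. i \<in> {1..K} \<Longrightarrow> gen_radius (b i) > 0"
    and "\<And>i. i \<in> {1..K} \<Longrightarrow> 0 < \<alpha>' i \<and> \<alpha>' i < \<alpha>'' i"
    and "\<And>i. i \<in> {1..K} \<Longrightarrow> \<exists>\<theta>\<in>params (b i). \<alpha>'' i = xi_mean (b i) \<theta>"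
    and "\<And>t. N t > 0"
    and "\<And>t. N t < N (Suc t)"
    and "\<And>i t. i \<in> {1..K} \<Longrightarrow> n t i > 0"
    and "\<And>i t. i \<in> {1..K} \<Longrightarrow>
           \<alpha>' i < real (n t i) / real (N t) \<and> real (n t i) / real (N t) < \<alpha>'' i"
    and "\<And>i. i \<in> {1..K} \<Longrightarrow> b i (s i) > 0"
    and "prob_space M"
    and "\<And>t i j. i \<in> {1..K} \<Longrightarrow> j \<in> {1..N t} \<Longrightarrow> \<eta> t i j \<in> measurable M (count_space UNIV)"
    and "\<And>t. allocation_possible K b (N t) (n t) \<Longrightarrow>
           allocation_scheme M K b (N t) (n t) (\<eta> t)"
  defines "\<mu> \<equiv> \<lambda>t. num_boxes K (N t) s (\<eta> t)"
    and "\<theta> \<equiv> \<lambda>t i. xi_mean_inv (b i) (real (n t i) / real (N t))"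
    and "p \<equiv> \<lambda>t. box_prob K b (\<theta> t) s"
    and "\<sigma> \<equiv> \<lambda>t. sqrt (p t * (1 - p t))"
  shows "AE \<omega> in M.
           limsup (\<lambda>t. ereal (\<bar>\<mu> t \<omega> - prob_space.expectation M (\<mu> t)\<bar> /
                              (sqrt (real (N t) * ln (real (N t))) * \<sigma> t)))
             \<le> ereal (4 * sqrt (1 + real K / 2))"
proof -
  let ?I = "{1..K}"
  define P where "P t i = measure_pmf.prob (xi_sample (b i) (\<theta> t i) (N t)) {x. (\<Sum>j=1..N t. x j) = n t i}" for t i
  let ?good = "\<lambda>i (z :: real \<times> real \<times> nat). fst z > 0 \<and> fst (snd z) > 0 \<and>
    (\<forall>\<alpha>. \<alpha>' i < \<alpha> \<longrightarrow> \<alpha> < \<alpha>'' i \<longrightarrow>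
      xi_mean_inv (b i) \<alpha> \<in> params (b i)
      \<and> fst (snd z) \<le> pmf (xi_pmf (b i) (xi_mean_inv (b i) \<alpha>)) (s i)
      \<and> pmf (xi_pmf (b i) (xi_mean_inv (b i) \<alpha>)) (s i) \<le> 1 - fst (snd z)
      \<and> (\<forall>N n. real n = real N * \<alpha> \<longrightarrow> N \<ge> snd (snd z) \<longrightarrow> fst z / sqrt (real N)
           \<le> measure_pmf.prob (xi_sample (b i) (xi_mean_inv (b i) \<alpha>) N) {x. (\<Sum>j=1..N. x j) = n}))"
  have "\<forall>i\<in>?I. \<exists>z. ?good i z"
  proof
    fix i assume i: "i \<in> ?I"
    show "\<exists>z. ?good i z"
      unfolding split_paired_Ex fst_conv snd_conv
      by (rule colour_uniform_bounds[of "b i", OF assms(2)[OF i] assms(3)[OF i] assms(4)[OF i] assms(12)[OF i]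
            conjunct1[OF assms(6)[OF i]] conjunct2[OF assms(6)[OF i]] assms(7)[OF i]])
  qed
  then obtain z where z: "\<forall>i\<in>?I. ?good i (z i)"
    by (rule bchoice[THEN exE])
  define c q N0 where "c i = fst (z i)" and "q i = fst (snd (z i))" and "N0 i = snd (snd (z i))" for i
  have c: "c i > 0" and q: "q i > 0" if "i \<in> ?I" for i
    using z that by (auto simp: c_def q_def)
  have z': "\<theta> t i \<in> params (b i) \<and> q i \<le> pmf (xi_pmf (b i) (\<theta> t i)) (s i)
      \<and> pmf (xi_pmf (b i) (\<theta> t i)) (s i) \<le> 1 - q i \<and> (N t \<ge> N0 i \<longrightarrow> c i / sqrt (real (N t)) \<le> P t i)"
    if i: "i \<in> ?I" for t i
  proof -
    have "real (n t i) = real (N t) * (real (n t i) / real (N t))"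
      using assms(8)[of t] by simp
    then show ?thesis
      using z[rule_format, OF i] assms(11)[OF i, of t]
      unfolding c_def q_def N0_def P_def \<theta>_def by blast
  qed
  have \<theta>: "\<theta> t i \<in> params (b i)" if "i \<in> ?I" for t i using z'[OF that] by blast

  have p_eq: "p t = (\<Prod>i\<in>?I. pmf (xi_pmf (b i) (\<theta> t i)) (s i))" for t
    unfolding p_def box_prob_def using assms(2,3) \<theta> by (intro prod.cong refl pmf_xi_pmf[symmetric]) auto
  have p_ge: "(\<Prod>i\<in>?I. q i) \<le> p t" for t
    unfolding p_eq using z' q by (intro prod_mono) (auto intro: less_imp_le)
  have one: "1 \<in> ?I" using assms(1) by simp
  \<comment> \<open>One colour alone, for which \<open>K \<ge> 1\<close> is needed, keeps the product away from \<open>1\<close>.\<close>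
  have p_le: "p t \<le> 1 - q 1" for t
  proof -
    have "p t = pmf (xi_pmf (b 1) (\<theta> t 1)) (s 1) * (\<Prod>i\<in>?I - {1}. pmf (xi_pmf (b i) (\<theta> t i)) (s i))"
      unfolding p_eq using one by (intro prod.remove) auto
    also have "\<dots> \<le> pmf (xi_pmf (b 1) (\<theta> t 1)) (s 1)"
      by (intro mult_right_le_one_le prod_nonneg prod_le_1) (auto simp: pmf_le_1)
    also have "\<dots> \<le> 1 - q 1" using z'[OF one] by blast
    finally show ?thesis .
  qed
  define v where "v = sqrt ((\<Prod>i\<in>?I. q i) * q 1)"
  have prod_q: "(\<Prod>i\<in>?I. q i) > 0" using q by (intro prod_pos) auto
  have v: "v > 0" unfolding v_def using prod_q q[OF one] by simp
  have \<sigma>_ge: "v \<le> \<sigma> t" for t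
    unfolding v_def \<sigma>_def using p_ge[of t] p_le[of t] prod_q q[OF one]
    by (intro real_sqrt_le_mono mult_mono) auto
  have p01: "0 \<le> p t" "p t \<le> 1" for t using p_ge[of t] p_le[of t] prod_q q[OF one] by linarith+
  define C where "C = 2 / (\<Prod>i\<in>?I. c i)"
  have prod_c: "(\<Prod>i\<in>?I. c i) > 0" using c by (intro prod_pos) auto
  have N_mono: "strict_mono N" using assms(9) by (simp add: strict_mono_Suc_iff)
  have N_lim: "filterlim N at_top sequentially" by (rule filterlim_subseq[OF N_mono])

  have tail: "eventually (\<lambda>t.
      measure M {\<omega> \<in> space M. \<bar>\<mu> t \<omega> - real (N t) * p t\<bar> \<ge> a * (sqrt (real (N t) * ln (real (N t))) * \<sigma> t)}
        \<le> C * real (N t) powr (real K / 2 - a\<^sup>2 / 4)) sequentially" if a: "a \<ge> 0" for a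
  proof -
    have "((\<lambda>m. sqrt (ln (real m) / real m)) \<longlongrightarrow> 0) at_top" by real_asymp
    moreover have "2 * v / (a + 1) > 0" using v a by simp
    ultimately have "eventually (\<lambda>m. sqrt (ln (real m) / real m) < 2 * v / (a + 1)) at_top"
      by (rule order_tendstoD(2))
    then have small: "eventually (\<lambda>t. sqrt (ln (real (N t)) / real (N t)) < 2 * v / (a + 1)) sequentially"
      using filterlim_iff[THEN iffD1, OF N_lim] by blast
    have large: "eventually (\<lambda>t. N t \<ge> (\<Sum>i\<in>?I. N0 i)) sequentially"
      using N_lim by (simp add: filterlim_at_top)
    show ?thesis
      using small large
    proof eventually_elim
      case (elim t)
      have N0: "N t \<ge> N0 i" if "i \<in> ?I" for i
        using elim(2) member_le_sum[OF that, of N0] by simp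
      have P_ge: "c i / sqrt (real (N t)) \<le> P t i" if "i \<in> ?I" for i
        using z'[OF that, of t] N0[OF that] by blast
      have Nt: "real (N t) > 0" using assms(8)[of t] by simp
      have ln0: "ln (real (N t)) \<ge> 0" using assms(8)[of t] by (intro ln_ge_zero) linarith
      have P_pos: "P t i > 0" if "i \<in> ?I" for i
        using less_le_trans[OF _ P_ge[OF that]] c[OF that] Nt by simp
      have "allocation_possible K b (N t) (n t)"
        unfolding allocation_possible_def using \<theta>[of _ t] P_pos by (intro exI[of _ "\<theta> t"]) (auto simp: P_def)
      then have scheme: "allocation_scheme M K b (N t) (n t) (\<eta> t)" by (rule assms(15))
      have \<sigma>0: "\<sigma> t > 0" using \<sigma>_ge[of t] v by linarith
      have \<sigma>2: "(\<sigma> t)\<^sup>2 = p t * (1 - p t)" using p01[of t] by (simp add: \<sigma>_def)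
      \<comment> \<open>This choice turns the Bernstein threshold \<open>2 l N p (1 - p)\<close> into \<open>a\<close> times the normalisation,
        and \<open>l \<le> 1\<close> for large \<open>t\<close> because \<open>\<sigma>\<close> is bounded below.\<close>
      define l where "l = a * sqrt (ln (real (N t)) / real (N t)) / (2 * \<sigma> t)"
      have l0: "0 \<le> l" using a \<sigma>0 ln0 by (simp add: l_def)
      have l1: "l \<le> 1"
      proof -
        have "a * sqrt (ln (real (N t)) / real (N t)) \<le> (a + 1) * sqrt (ln (real (N t)) / real (N t))"
          using ln0 by (intro mult_right_mono) auto
        also have "\<dots> \<le> 2 * v" using elim(1) a by (simp add: field_simps)
        also have "\<dots> \<le> 2 * \<sigma> t" using \<sigma>_ge[of t] by simp
        finally show ?thesis using \<sigma>0 by (simp add: l_def)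
      qed
      have sq: "sqrt (ln (real (N t)) / real (N t)) * real (N t) = sqrt (real (N t) * ln (real (N t)))"
      proof -
        have "sqrt (ln (real (N t)) / real (N t)) * real (N t)
            = sqrt (ln (real (N t)) / real (N t)) * sqrt (real (N t) * real (N t))" by simp
        also have "\<dots> = sqrt (real (N t) * ln (real (N t)))"
          unfolding real_sqrt_mult[symmetric] using Nt by simp
        finally show ?thesis .
      qed
      have r: "2 * l * real (N t) * (p t * (1 - p t)) = a * (sqrt (real (N t) * ln (real (N t))) * \<sigma> t)"
        unfolding \<sigma>2[symmetric] sq[symmetric] l_def using \<sigma>0 by (simp add: power2_eq_square)
      have "l\<^sup>2 * (real (N t) * (\<sigma> t)\<^sup>2) = a\<^sup>2 * ln (real (N t)) / 4"
        unfolding l_def using \<sigma>0 Nt ln0 by (simp add: power_divide power_mult_distrib)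
      then have e: "exp (- (l\<^sup>2 * real (N t) * (p t * (1 - p t)))) = real (N t) powr (- (a\<^sup>2 / 4))"
        unfolding \<sigma>2[symmetric] using Nt by (simp add: powr_def mult.assoc)
      have "(\<Prod>i\<in>?I. c i) / sqrt (real (N t)) ^ K = (\<Prod>i\<in>?I. c i / sqrt (real (N t)))"
        by (simp add: prod_dividef)
      also have "\<dots> \<le> (\<Prod>i\<in>?I. P t i)"
        using P_ge by (intro prod_mono) (auto intro!: divide_nonneg_nonneg less_imp_le[OF c])
      finally have prod_P: "(\<Prod>i\<in>?I. c i) / sqrt (real (N t)) ^ K \<le> (\<Prod>i\<in>?I. P t i)" .
      have sqK: "sqrt (real (N t)) ^ K = real (N t) powr (real K / 2)"
        using Nt by (simp add: powr_half_sqrt[symmetric] powr_powr powr_realpow[symmetric])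
      have "measure M {\<omega> \<in> space M. \<bar>\<mu> t \<omega> - real (N t) * p t\<bar> \<ge> a * (sqrt (real (N t) * ln (real (N t))) * \<sigma> t)}
          \<le> 2 * exp (- (l\<^sup>2 * real (N t) * (p t * (1 - p t)))) / (\<Prod>i\<in>?I. P t i)"
        unfolding r[symmetric] \<mu>_def P_def
      proof (rule num_boxes_tail[OF assms(13) assms(14) _ _ \<theta> scheme])
        show "p t = box_prob K b (\<theta> t) s" by (simp add: p_def)
      qed (use assms(2,3) P_pos l0 l1 in \<open>simp_all add: P_def\<close>)
      also have "\<dots> \<le> 2 * exp (- (l\<^sup>2 * real (N t) * (p t * (1 - p t)))) / ((\<Prod>i\<in>?I. c i) / sqrt (real (N t)) ^ K)"
        using prod_c Nt by (intro divide_left_mono[OF prod_P] mult_pos_pos) (auto intro!: prod_pos P_pos)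
      also have "\<dots> = C * (real (N t) powr (real K / 2) * real (N t) powr (- (a\<^sup>2 / 4)))"
        unfolding e sqK C_def by simp
      also have "\<dots> = C * real (N t) powr (real K / 2 - a\<^sup>2 / 4)"
        by (simp add: powr_add[symmetric])
      finally show ?case .
    qed
  qed

  show ?thesis
  proof (rule limsup_deviation_from_mean_le[OF assms(13) _ _ N_mono v \<sigma>_ge _ _ tail])
    show "\<mu> t \<in> borel_measurable M" for t
      unfolding \<mu>_def num_boxes_def
    proof (intro borel_measurable_sum borel_measurable_prod)
      fix i j assume "j \<in> {1..N t}" "i \<in> ?I"
      then show "(\<lambda>\<omega>. of_bool (\<eta> t i j \<omega> = s i) :: real) \<in> borel_measurable M"
        by (intro measurable_compose[OF assms(14)]) auto
    qed
    show "\<bar>\<mu> t \<omega> - real (N t) * p t\<bar> \<le> real (N t)" for t \<omega>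
    proof -
      have "0 \<le> \<mu> t \<omega>" unfolding \<mu>_def num_boxes_def by (intro sum_nonneg prod_nonneg) auto
      moreover have "\<mu> t \<omega> \<le> real (card {1..N t}) * 1"
        unfolding \<mu>_def num_boxes_def by (intro sum_bounded_above prod_le_1) auto
      moreover have "0 \<le> real (N t) * p t" "real (N t) * p t \<le> real (N t)"
        using p01[of t] by (auto intro: mult_left_le)
      ultimately show ?thesis by simp
    qed
    show "0 \<le> C" unfolding C_def using prod_c by simp
  qed auto
qed

end
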